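(* Let $2\le p\le q\le\infty$ and let $E$ be a locally convex space with the Rosenthal property. Then every $(p,q)$-$(V^\ast)$ subset of $E$ is weakly sequentially precompact. Consequently, every $(p,q)$-limited subset of $E$ is weakly sequentially precompact.
   Context: All locally convex spaces (lcs) are Hausdorff over $\mathbb F\in\{\mathbb R,\mathbb C\}$. $E'$ denotes the topological dual of $E$; $E'_{w^*}$ is $E'$ with the weak$^*$ topology $\sigma(E',E)$ and $E'_\beta$ is $E'$ with the strong topology $\beta(E',E)$. For $A\subseteq E$ and $\chi\in E'$, $\|\chi\|_A:=\sup\{|\chi(x)|: x\in A\cup\{0\}\}$. For $p\in[1,\infty]$, a sequence $(x_n)$ in an lcs $H$ is weakly $p$-summable if for every $\chi\in H'$ the scalar sequence $(\chi(x_n))_n$ lies in $\ell_p$ (if $p<\infty$) or in $c_0$ (if $p=\infty$). A sequence $(\chi_n)$ in $E'$ is weak$^*$ $p$-summable if it is weakly $p$-summable in $E'_{w^*}$, i.e. $(\chi_n(x))_n\in\ell_p$ (resp. $c_0$ if $p=\infty$) for every $x\in E$. For $p,q\in[1,\infty]$, a nonempty $A\subseteq E$ is a $(p,q)$-$(V^\ast)$ set if for every weakly $p$-summable sequence $(\chi_n)$ in $E'_\beta$, the sequence $(\sup_{a\in A}|\chi_n(a)|)_n$ lies in $\ell_q$ if $q<\infty$ and in $c_0$ if $q=\infty$. For $1\le p\le q\le\infty$, a nonempty $A\subseteq E$ is $(p,q)$-limited if for every weak$^*$ $p$-summable sequence $(\chi_n)$ in $E'$, $(\|\chi_n\|_A)_n\in\ell_q$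 if $q<\infty$, and $\|\chi_n\|_A\to0$ if $q=\infty$. A set $A\subseteq E$ is weakly sequentially precompact if every sequence in $A$ has a subsequence which is Cauchy in the weak topology $\sigma(E,E')$. A sequence $(a_n)$ in $E$ is equivalent to the unit basis of $\ell_1$ if there is a linear topological isomorphism $R$ from the closed linear span of $\{a_n\}$ onto a subspace of $\ell_1$ with $R(a_n)=e_n$ for all $n$ ($e_n$ the standard unit vectors). $E$ has the Rosenthal property if every bounded sequence in $E$ has a subsequence which is either weakly Cauchy or equivalent to the unit basis of $\ell_1$. *)

theory Defs
  imports "HOL-Analysis.Analysis"
begin

text \<open>A (Hausdorff) locally convex space over a field 'k (a real normed field, i.e. R or C)
  is represented by a vector space structure (scalar multiplication sm) on a type 'a together with a
  separating family of seminorms P i, i ranging over an index type 'i, generating its topology.\<close>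

definition seminorm :: "('k::real_normed_field \<Rightarrow> 'a::ab_group_add \<Rightarrow> 'a) \<Rightarrow> ('a \<Rightarrow> real) \<Rightarrow> bool" where
  "seminorm sm p \<longleftrightarrow> (\<forall>x y. p (x + y) \<le> p x + p y) \<and> (\<forall>c x. p (sm c x) = norm c * p x)"

definition lcs :: "('k::real_normed_field \<Rightarrow> 'a::ab_group_add \<Rightarrow> 'a) \<Rightarrow> ('i \<Rightarrow> 'a \<Rightarrow> real) \<Rightarrow> bool" where
  "lcs sm P \<longleftrightarrow> vector_space sm \<and> (\<forall>i. seminorm sm (P i)) \<and>
     (\<forall>x. (\<forall>i. P i x = 0) \<longrightarrow> x = 0)"

definition lcs_closure :: "('i \<Rightarrow> 'a::ab_group_add \<Rightarrow> real) \<Rightarrow> 'a set \<Rightarrow> 'a set" where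
  "lcs_closure P S = {x. \<forall>I (\<epsilon>::real). finite I \<and> \<epsilon> > 0 \<longrightarrow> (\<exists>y\<in>S. (\<Sum>i\<in>I. P i (x - y)) < \<epsilon>)}"

definition dual :: "('k::real_normed_field \<Rightarrow> 'a::ab_group_add \<Rightarrow> 'a) \<Rightarrow> ('i \<Rightarrow> 'a \<Rightarrow> real) \<Rightarrow> ('a \<Rightarrow> 'k) set" where
  "dual sm P = {f. Vector_Spaces.linear sm (*) f \<and>
     (\<exists>I C. finite I \<and> (\<forall>x. norm (f x) \<le> C * (\<Sum>i\<in>I. P i x)))}"

definition lcs_bounded :: "('i \<Rightarrow> 'a \<Rightarrow> real) \<Rightarrow> 'a set \<Rightarrow> bool" where
  "lcs_bounded P B \<longleftrightarrow> (\<forall>i. \<exists>M. \<forall>x\<in>B. P i x \<le> M)"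

definition supnorm_on :: "('a::zero \<Rightarrow> 'k::real_normed_field) \<Rightarrow> 'a set \<Rightarrow> ereal" where
  "supnorm_on ch A = (SUP x\<in>insert 0 A. ereal (norm (ch x)))"

definition in_lp :: "ereal \<Rightarrow> (nat \<Rightarrow> real) \<Rightarrow> bool" where
  "in_lp p a \<longleftrightarrow> (if p = \<infinity> then a \<longlonglongrightarrow> 0 else summable (\<lambda>n. \<bar>a n\<bar> powr real_of_ereal p))"

text \<open>Continuous linear functionals on the strong dual \<open>E'_\<beta>\<close>: linear functionals on E' bounded by
  a multiple of \<open>\<parallel>\<cdot>\<parallel>_B\<close> for some bounded \<open>B \<subseteq> E\<close> (these seminorms generate \<open>\<beta>(E',E)\<close>).\<close>
definition strong_bidual :: "('k::real_normed_field \<Rightarrow> 'a::ab_group_add \<Rightarrow> 'a) \<Rightarrow> ('i \<Rightarrow> 'a \<Rightarrow> real) \<Rightarrow> (('a \<Rightarrow> 'k) \<Rightarrow> 'k) set" where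
  "strong_bidual sm P = {\<Phi>.
     (\<forall>f\<in>dual sm P. \<forall>g\<in>dual sm P. \<Phi> (\<lambda>x. f x + g x) = \<Phi> f + \<Phi> g) \<and>
     (\<forall>f\<in>dual sm P. \<forall>c. \<Phi> (\<lambda>x. c * f x) = c * \<Phi> f) \<and>
     (\<exists>B C. lcs_bounded P B \<and> (\<forall>f\<in>dual sm P. ereal (norm (\<Phi> f)) \<le> ereal C * supnorm_on f B))}"

definition weakly_p_summable_strong_dual ::
  "('k::real_normed_field \<Rightarrow> 'a::ab_group_add \<Rightarrow> 'a) \<Rightarrow> ('i \<Rightarrow> 'a \<Rightarrow> real) \<Rightarrow> ereal \<Rightarrow> (nat \<Rightarrow> 'a \<Rightarrow> 'k) \<Rightarrow> bool" where
  "weakly_p_summable_strong_dual sm P p ch \<longleftrightarrow> (\<forall>n. ch n \<in> dual sm P) \<and>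
     (\<forall>\<Phi>\<in>strong_bidual sm P. in_lp p (\<lambda>n. norm (\<Phi> (ch n))))"

definition weak_star_p_summable ::
  "('k::real_normed_field \<Rightarrow> 'a::ab_group_add \<Rightarrow> 'a) \<Rightarrow> ('i \<Rightarrow> 'a \<Rightarrow> real) \<Rightarrow> ereal \<Rightarrow> (nat \<Rightarrow> 'a \<Rightarrow> 'k) \<Rightarrow> bool" where
  "weak_star_p_summable sm P p ch \<longleftrightarrow> (\<forall>n. ch n \<in> dual sm P) \<and>
     (\<forall>x. in_lp p (\<lambda>n. norm (ch n x)))"

definition pq_Vstar_set ::
  "('k::real_normed_field \<Rightarrow> 'a::ab_group_add \<Rightarrow> 'a) \<Rightarrow> ('i \<Rightarrow> 'a \<Rightarrow> real) \<Rightarrow> ereal \<Rightarrow> ereal \<Rightarrow> 'a set \<Rightarrow> bool" where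
  "pq_Vstar_set sm P p q A \<longleftrightarrow> A \<noteq> {} \<and>
     (\<forall>ch. weakly_p_summable_strong_dual sm P p ch \<longrightarrow>
        (\<forall>n. (SUP a\<in>A. ereal (norm (ch n a))) < \<infinity>) \<and>
        in_lp q (\<lambda>n. real_of_ereal (SUP a\<in>A. ereal (norm (ch n a)))))"

definition pq_limited_set ::
  "('k::real_normed_field \<Rightarrow> 'a::ab_group_add \<Rightarrow> 'a) \<Rightarrow> ('i \<Rightarrow> 'a \<Rightarrow> real) \<Rightarrow> ereal \<Rightarrow> ereal \<Rightarrow> 'a set \<Rightarrow> bool" where
  "pq_limited_set sm P p q A \<longleftrightarrow> A \<noteq> {} \<and>
     (\<forall>ch. weak_star_p_summable sm P p ch \<longrightarrow>
        (\<forall>n. supnorm_on (ch n) A < \<infinity>) \<and>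
        in_lp q (\<lambda>n. real_of_ereal (supnorm_on (ch n) A)))"

definition weakly_Cauchy ::
  "('k::real_normed_field \<Rightarrow> 'a::ab_group_add \<Rightarrow> 'a) \<Rightarrow> ('i \<Rightarrow> 'a \<Rightarrow> real) \<Rightarrow> (nat \<Rightarrow> 'a) \<Rightarrow> bool" where
  "weakly_Cauchy sm P x \<longleftrightarrow> (\<forall>f\<in>dual sm P. Cauchy (\<lambda>n. f (x n)))"

definition weakly_seq_precompact ::
  "('k::real_normed_field \<Rightarrow> 'a::ab_group_add \<Rightarrow> 'a) \<Rightarrow> ('i \<Rightarrow> 'a \<Rightarrow> real) \<Rightarrow> 'a set \<Rightarrow> bool" where
  "weakly_seq_precompact sm P A \<longleftrightarrow>
     (\<forall>x. (\<forall>n. x n \<in> A) \<longrightarrow> (\<exists>r::nat \<Rightarrow> nat. strict_mono r \<and> weakly_Cauchy sm P (x \<circ> r)))"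

definition l1_space :: "(nat \<Rightarrow> 'k::real_normed_field) set" where
  "l1_space = {y. summable (\<lambda>n. norm (y n))}"

definition l1_norm :: "(nat \<Rightarrow> 'k::real_normed_field) \<Rightarrow> real" where
  "l1_norm y = (\<Sum>n. norm (y n))"

definition unit_vec :: "nat \<Rightarrow> nat \<Rightarrow> 'k::real_normed_field" where
  "unit_vec n = (\<lambda>m. if m = n then 1 else 0)"

text \<open>A sequence (a n) is equivalent to the unit basis of \<open>\<ell>_1\<close>: there is a linear topological
  isomorphism R from the closed linear span S of {a n} onto a subspace of \<open>\<ell>_1\<close> with
  R (a n) = e_n. Continuity of the linear maps R and \<open>R\<^sup>-\<^sup>1\<close> is expressed via the seminorms.\<close>
definition equiv_l1_basis ::
  "('k::real_normed_field \<Rightarrow> 'a::ab_group_add \<Rightarrow> 'a) \<Rightarrow> ('i \<Rightarrow> 'a \<Rightarrow> real) \<Rightarrow> (nat \<Rightarrow> 'a) \<Rightarrow> bool" where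
  "equiv_l1_basis sm P a \<longleftrightarrow>
     (let S = lcs_closure P (module.span sm (range a)) in
      \<exists>R :: 'a \<Rightarrow> nat \<Rightarrow> 'k.
        (\<forall>x\<in>S. R x \<in> l1_space) \<and>
        (\<forall>x\<in>S. \<forall>y\<in>S. R (x + y) = (\<lambda>m. R x m + R y m)) \<and>
        (\<forall>x\<in>S. \<forall>c. R (sm c x) = (\<lambda>m. c * R x m)) \<and>
        inj_on R S \<and>
        (\<forall>n. R (a n) = unit_vec n) \<and>
        (\<exists>I C. finite I \<and> (\<forall>x\<in>S. l1_norm (R x) \<le> C * (\<Sum>i\<in>I. P i x))) \<and>
        (\<forall>i. \<exists>C. \<forall>x\<in>S. P i x \<le> C * l1_norm (R x)))"

definition rosenthal_property ::
  "('k::real_normed_field \<Rightarrow> 'a::ab_group_add \<Rightarrow> 'a) \<Rightarrow> ('i \<Rightarrow> 'a \<Rightarrow> real) \<Rightarrow> bool" where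
  "rosenthal_property sm P \<longleftrightarrow>
     (\<forall>x. lcs_bounded P (range x) \<longrightarrow>
        (\<exists>r::nat \<Rightarrow> nat. strict_mono r \<and> (weakly_Cauchy sm P (x \<circ> r) \<or> equiv_l1_basis sm P (x \<circ> r))))"

end

theory Submission
  imports Defs "HOL-Computational_Algebra.Computational_Algebra"
begin

text \<open>
  A \<open>(p,q)\<close>-\<open>(V\<^sup>*)\<close> set is bounded: otherwise norming functionals, scaled by \<open>2\<^sup>-\<^sup>n\<close>, form a weakly
  \<open>p\<close>-summable sequence that does not tend to 0 uniformly on the set. By the Rosenthal property it
  remains to exclude a sequence \<open>a\<close> in the set equivalent to the unit basis of \<open>\<ell>\<^sub>1\<close>, for which it
  suffices to find a weakly 2-summable sequence \<open>\<chi>\<close> in the strong dual with \<open>\<chi>\<^sub>n(a\<^sub>n) = 1\<close>.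

  Write \<open>R\<close> for the isomorphism into \<open>\<ell>\<^sub>1\<close> and \<open>p\<close> for a continuous seminorm with \<open>\<parallel>R x\<parallel> \<le> p x\<close>.
  On the finitely supported sequences \<open>u\<close> in \<open>E\<close> consider the seminorm given by the mean of
  \<open>p (\<Sum>\<^sub>n \<epsilon>\<^sub>n u\<^sub>n)\<close> over all signs \<open>\<epsilon>\<close>. It dominates \<open>\<bar>\<Sum>\<^sub>n (R u\<^sub>n)\<^sub>n\<bar>\<close> for sequences in the span of
  \<open>a\<close>, so this functional extends by Hahn-Banach to some \<open>F\<close>, and \<open>\<chi>\<^sub>n x\<close> is the value of \<open>F\<close> at the
  sequence with the single entry \<open>x\<close> at \<open>n\<close>. For \<open>u\<^sub>n = c\<^sub>n x\<close> the mean is at most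
  \<open>p x (\<Sum>\<^sub>n \<bar>c\<^sub>n\<bar>\<^sup>2)\<^sup>1\<^sup>/\<^sup>2\<close> by the parallelogram law, which is the weak 2-summability of \<open>\<chi>\<close>.

  Hahn-Banach and the parallelogram law hold for scalars in an abstract real normed field because, by
  the Gelfand-Mazur theorem, such a field is \<open>\<real>\<close> or \<open>\<complex>\<close>.
\<close>

section \<open>Real normed fields\<close>

lemma map_poly_of_real_mult:
  "map_poly of_real (p * q) = (map_poly of_real p * map_poly of_real q :: 'k::{real_algebra_1,comm_ring_1} poly)"
  by (rule poly_eqI) (simp add: coeff_map_poly coeff_mult)

lemma map_poly_of_real_prod:
  "map_poly of_real (prod f I) = (\<Prod>i\<in>I. map_poly of_real (f i) :: 'k::{real_algebra_1,comm_ring_1} poly)"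
  by (induction I rule: infinite_finite_induct) (auto simp: map_poly_of_real_mult)

lemma map_poly_of_real_power:
  "map_poly of_real (p ^ n) = (map_poly of_real p ^ n :: 'k::{real_algebra_1,comm_ring_1} poly)"
  by (induction n) (auto simp: map_poly_of_real_mult)

lemma map_poly_of_real_diff:
  "map_poly of_real (p - q) = (map_poly of_real p - map_poly of_real q :: 'k::{real_algebra_1,comm_ring_1} poly)"
  by (rule poly_eqI) (simp add: coeff_map_poly)

text \<open>The value at \<open>z\<close> of the real polynomial (X - w)(X - conj w). Its
  coefficients are real, so it makes sense in \<open>'k\<close> although \<open>w\<close> is
  complex.\<close>

definition conj_quadratic :: "complex \<Rightarrow> 'k::real_normed_field \<Rightarrow> 'k" where
  "conj_quadratic w z = z\<^sup>2 - of_real (2 * Re w) * z + of_real ((cmod w)\<^sup>2)"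

text \<open>Over the complex numbers \<open>h\<close> splits into linear factors. Pairing each
  factor with its conjugate turns the square of \<open>h\<close> into a product of
  \<open>degree h\<close> real quadratics, whose values at \<open>z\<close> are values of
  \<open>conj_quadratic\<close>; hence the square on the right-hand side.\<close>

lemma monic_real_poly_norm_ge:
  fixes z :: "'k::real_normed_field" and h :: "real poly"
  assumes m: "\<And>w. m \<le> norm (conj_quadratic w z)" and "0 \<le> m" and h: "lead_coeff h = 1"
  shows "m ^ degree h \<le> (norm (poly (map_poly of_real h) z))\<^sup>2"
proof -
  define H where "H = map_poly complex_of_real h"
  have deg: "degree H = degree h"
    unfolding H_def by (rule degree_map_poly) auto
  have lead: "lead_coeff H = 1"
    unfolding deg by (simp add: H_def coeff_map_poly h)
  obtain root where "smult (lead_coeff H) (\<Prod>i<degree H. [:-root i, 1:]) = H"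
    using complex_poly_decompose' .
  then have H: "H = (\<Prod>i<degree h. [:-root i, 1:])"
    using lead deg by simp
  define Q where "Q i = [:(cmod (root i))\<^sup>2, - 2 * Re (root i), 1:]" for i
  \<comment> \<open>It suffices to compare values at real x, where the square of h(x) is the squared
    modulus of the product of the x - root i.\<close>
  have "poly (h * h) x = poly (\<Prod>i<degree h. Q i) x" for x
  proof -
    have "complex_of_real (poly h x) = poly H (of_real x)"
      unfolding H_def by (induction h) (auto simp: map_poly_pCons)
    also have "\<dots> = (\<Prod>i<degree h. of_real x - root i)"
      unfolding H by (simp add: poly_prod)
    finally have "cmod (complex_of_real (poly h x)) = (\<Prod>i<degree h. cmod (of_real x - root i))"
      by (simp only: prod_norm)
    then have "(poly h x)\<^sup>2 = (\<Prod>i<degree h. cmod (of_real x - root i))\<^sup>2"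
      by (metis norm_of_real power2_abs)
    also have "\<dots> = (\<Prod>i<degree h. (cmod (of_real x - root i))\<^sup>2)"
      by (simp add: prod_power_distrib)
    also have "\<dots> = poly (\<Prod>i<degree h. Q i) x"
      by (simp add: poly_prod Q_def cmod_power2) (simp add: power2_eq_square algebra_simps)
    finally show ?thesis by (simp add: power2_eq_square)
  qed
  then have hh: "h * h = (\<Prod>i<degree h. Q i)"
    by (simp add: poly_eq_poly_eq_iff[symmetric] fun_eq_iff)
  have ev: "poly (map_poly of_real (Q i)) z = conj_quadratic (root i) z" for i
    by (simp add: Q_def conj_quadratic_def map_poly_pCons power2_eq_square algebra_simps)
  have "m ^ degree h = (\<Prod>i<degree h. m)" by simp
  also have "\<dots> \<le> (\<Prod>i<degree h. norm (conj_quadratic (root i) z))"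
    by (rule prod_mono) (use m \<open>0 \<le> m\<close> in auto)
  also have "\<dots> = norm (poly (map_poly of_real (h * h)) z)"
    by (simp add: hh map_poly_of_real_prod poly_prod ev prod_norm)
  also have "\<dots> = (norm (poly (map_poly of_real h) z))\<^sup>2"
    by (simp add: map_poly_of_real_mult norm_mult power2_eq_square)
  finally show ?thesis .
qed

text \<open>The Gelfand-Mazur theorem: if \<open>y = conj_quadratic w0 z\<close> had minimal norm \<open>m > 0\<close>, then the
  factorisation of \<open>y\<^sup>n - (-e)\<^sup>n\<close>, whose cofactor of \<open>y + e\<close> has norm at least \<open>m\<^sup>n\<^sup>-\<^sup>1\<close>, would show that
  \<open>y + e\<close> is again a minimiser for \<open>0 \<le> e < m\<close>. Iterating contradicts \<open>norm (y + t) \<ge> t - m\<close>.\<close>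

lemma norm_conj_quadratic_minimizer_shift:
  fixes z :: "'k::real_normed_field"
  assumes min: "\<And>w. norm (conj_quadratic w0 z) \<le> norm (conj_quadratic w z)"
    and e: "0 \<le> e" "e < norm (conj_quadratic w0 z)"
  shows "norm (conj_quadratic w0 z + of_real e) \<le> norm (conj_quadratic w0 z)"
proof -
  define y where "y = conj_quadratic w0 z"
  define m where "m = norm y"
  have m: "0 < m" "e < m" using e by (auto simp: m_def y_def)
  define g where "g = [:(cmod w0)\<^sup>2, - 2 * Re w0, 1:]"
  have evg: "poly (map_poly of_real g) z = y"
    by (simp add: g_def y_def conj_quadratic_def map_poly_pCons power2_eq_square algebra_simps)
  have degg: "degree g = 2" "lead_coeff g = 1" by (auto simp: g_def)
  have bound: "norm (y + of_real e) \<le> m + e * (e / m) ^ k" for k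
  proof -
    \<comment> \<open>Taking \<open>-e\<close> as the second base makes the factor
      \<open>g - [:-e:]\<close> evaluate to \<open>y + of_real e\<close>.\<close>
    define G where "G = (\<Sum>i<Suc k. [:-e:] ^ (Suc k - Suc i) * g ^ i)"
    have fact: "g ^ Suc k - [:-e:] ^ Suc k = (g - [:-e:]) * G"
      unfolding G_def by (rule power_diff_sumr2)
    have c: "[:-e:] ^ Suc k = [:(-e) ^ Suc k:]"
      by (simp only: poly_const_pow)
    have dg: "degree (g ^ Suc k) = 2 * Suc k"
      using degg by (subst degree_power_eq) auto
    have d: "degree (g ^ Suc k - [:-e:] ^ Suc k) = 2 * Suc k"
      unfolding c diff_conv_add_uminus by (subst degree_add_eq_left) (auto simp: dg simp del: power_Suc)
    have l: "lead_coeff (g ^ Suc k - [:-e:] ^ Suc k) = 1"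
      using dg degg lead_coeff_power[of g "Suc k"]
      unfolding d unfolding c by (simp add: coeff_pCons del: power_Suc)
    have g1: "lead_coeff (g - [:-e:]) = 1" "degree (g - [:-e:]) = 2"
      by (auto simp: g_def)
    have lG: "lead_coeff G = 1"
      using l g1 unfolding fact lead_coeff_mult by simp
    then have G0: "G \<noteq> 0" by auto
    have "degree ((g - [:-e:]) * G) = degree (g - [:-e:]) + degree G"
      using g1 G0 by (intro degree_mult_eq) auto
    then have dG: "degree G = 2 * k"
      using d g1 unfolding fact by simp
    \<comment> \<open>\<open>degree G\<close> is 2k, which cancels the square in the bound and
      leaves \<open>m ^ k\<close>.\<close>
    have "m ^ degree G \<le> (norm (poly (map_poly of_real G) z))\<^sup>2"
      by (rule monic_real_poly_norm_ge) (use min lG in \<open>auto simp: m_def y_def\<close>)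
    then have mk: "m ^ k \<le> norm (poly (map_poly of_real G) z)"
      unfolding dG using m
      by (metis norm_ge_zero power2_le_imp_le power_even_eq)
    have "poly (map_poly of_real ((g - [:-e:]) * G)) z = (y + of_real e) * poly (map_poly of_real G) z"
      by (simp only: map_poly_of_real_mult map_poly_of_real_diff poly_mult poly_diff evg)
         (simp add: map_poly_pCons)
    moreover have "poly (map_poly of_real (g ^ Suc k - [:-e:] ^ Suc k)) z = y ^ Suc k - of_real ((-e) ^ Suc k)"
      by (simp only: c map_poly_of_real_diff map_poly_of_real_power poly_diff poly_power evg)
         (simp add: map_poly_pCons)
    ultimately have "norm (y + of_real e) * norm (poly (map_poly of_real G) z)
        = norm (y ^ Suc k - of_real ((-e) ^ Suc k))"
      unfolding fact by (metis norm_mult)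
    also have "\<dots> \<le> norm (y ^ Suc k) + norm (of_real ((-e) ^ Suc k) :: 'k)"
      by (rule norm_triangle_ineq4)
    also have "\<dots> = m ^ Suc k + e ^ Suc k"
      using e by (simp only: norm_of_real norm_power power_abs m_def) simp
    finally have "norm (y + of_real e) * m ^ k \<le> m ^ Suc k + e ^ Suc k"
      using mult_left_mono[OF mk, of "norm (y + of_real e)"] by simp
    then show ?thesis using m
      by (simp add: field_simps)
  qed
  have "(\<lambda>k. m + e * (e / m) ^ k) \<longlonglongrightarrow> m + e * 0"
    by (intro tendsto_intros LIMSEQ_realpow_zero) (use e m in auto)
  then have "norm (y + of_real e) \<le> m"
    using LIMSEQ_le_const bound by fastforce
  then show ?thesis by (simp add: y_def m_def)
qed

lemma real_normed_field_quadratic_root: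
  fixes z :: "'k::real_normed_field"
  shows "\<exists>w. conj_quadratic w z = 0"
proof -
  define N where "N w = norm (conj_quadratic w z)" for w
  \<comment> \<open>The radius is chosen so that outside the ball \<open>N w\<close> is at least
    twice the square of \<open>norm z\<close>, hence at least \<open>N 0\<close>; the minimum over
    the compact ball is therefore global.\<close>
  have "continuous_on (cball 0 (3 * norm z)) N"
    unfolding N_def conj_quadratic_def by (intro continuous_intros)
  then obtain w0 where w0: "\<And>w. cmod w \<le> 3 * norm z \<Longrightarrow> N w0 \<le> N w"
    using continuous_attains_inf[of "cball (0::complex) (3 * norm z)" N] by (force simp: mem_cball_0)
  have min: "N w0 \<le> N w" for w
  proof (cases "cmod w \<le> 3 * norm z")
    case False
    have "(cmod w)\<^sup>2 = norm (conj_quadratic w z - z\<^sup>2 + of_real (2 * Re w) * z)"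
      by (simp add: conj_quadratic_def norm_power)
    also have "\<dots> \<le> N w + norm (z\<^sup>2) + norm (of_real (2 * Re w) * z)"
      unfolding N_def by (meson norm_triangle_ineq norm_triangle_ineq4 order_trans add_mono order_refl)
    also have "\<dots> = N w + (norm z)\<^sup>2 + 2 * \<bar>Re w\<bar> * norm z"
      by (simp add: norm_power norm_mult)
    also have "\<dots> \<le> N w + (norm z)\<^sup>2 + 2 * cmod w * norm z"
      using abs_Re_le_cmod[of w] by (simp add: mult_right_mono)
    finally have "cmod w * (cmod w - 2 * norm z) \<le> N w + (norm z)\<^sup>2"
      by (simp add: power2_eq_square algebra_simps)
    moreover have "(3 * norm z) * norm z \<le> cmod w * (cmod w - 2 * norm z)"
      using False by (intro mult_mono) auto
    moreover have "N 0 = (norm z)\<^sup>2"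
      by (simp add: N_def conj_quadratic_def norm_power)
    moreover have "N w0 \<le> N 0" by (rule w0) simp
    moreover have "0 \<le> norm z * norm z" by simp
    ultimately show ?thesis unfolding power2_eq_square by linarith
  qed (rule w0)
  define m where "m = N w0"
  have "m = 0"
  proof (rule ccontr)
    assume "m \<noteq> 0"
    then have m: "m > 0" by (simp add: m_def N_def)
    have iter: "\<exists>w. N w = m \<and> conj_quadratic w z = conj_quadratic w0 z + of_real (real k * (m / 2))" for k
    proof (induction k)
      case 0
      then show ?case by (auto simp: m_def)
    next
      case (Suc k)
      then obtain w where w: "N w = m" "conj_quadratic w z = conj_quadratic w0 z + of_real (real k * (m / 2))"
        by blast
      \<comment> \<open>Enlarging only the imaginary part adds m/2 to the squared modulus and keeps
        the real part, so the shifted value is again a value of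
        \<open>conj_quadratic\<close>.\<close>
      define w' where "w' = Complex (Re w) (sqrt ((Im w)\<^sup>2 + m / 2))"
      have eq: "conj_quadratic w' z = conj_quadratic w z + of_real (m / 2)"
        using m by (simp add: conj_quadratic_def w'_def cmod_power2)
      have "norm (conj_quadratic w z + of_real (m / 2)) \<le> norm (conj_quadratic w z)"
        by (rule norm_conj_quadratic_minimizer_shift) (use w(1) min m in \<open>auto simp: m_def N_def\<close>)
      then have "N w' \<le> m" using w(1) unfolding eq[symmetric] N_def by simp
      with min[of w'] have "N w' = m" by (simp add: m_def)
      moreover have "conj_quadratic w' z = conj_quadratic w0 z + of_real (real (Suc k) * (m / 2))"
        unfolding eq w(2) by (simp add: algebra_simps)
      ultimately show ?case by blast
    qed
    \<comment> \<open>Five steps move the value by 5m/2, more than the 2m by which two values of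
      norm \<open>m\<close> can differ.\<close>
    obtain w where w: "N w = m" "conj_quadratic w z = conj_quadratic w0 z + of_real (real 5 * (m / 2))"
      using iter by blast
    have "norm (of_real (real 5 * (m / 2)) :: 'k) = norm (conj_quadratic w z - conj_quadratic w0 z)"
      unfolding w(2) by simp
    also have "\<dots> \<le> N w + N w0" unfolding N_def by (rule norm_triangle_ineq4)
    finally show False using m w(1) by (simp add: m_def norm_divide norm_mult)
  qed
  then show ?thesis by (auto simp: m_def N_def)
qed

text \<open>Every element is a root of a real quadratic, and completing the square produces a square
  root \<open>j\<close> of -1 from any non-real element. The isometry is then a + ib \<mapsto> a + b
  j.\<close>

lemma real_normed_field_cases:
  "(\<forall>z::'k::real_normed_field. z \<in> \<real>) \<or>
   (\<exists>h :: complex \<Rightarrow> 'k. surj h \<and> (\<forall>c. norm (h c) = cmod c) \<and> (\<forall>c d. h (c + d) = h c + h d) \<and>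
      (\<forall>c d. h (c * d) = h c * h d) \<and> (\<forall>r. h (of_real r) = of_real r))"
proof (cases "\<forall>z::'k. z \<in> \<real>")
  case False
  have root: "\<exists>a b j. z = of_real a + of_real b * j \<and> j\<^sup>2 = -1" if "z \<notin> \<real>" for z :: 'k
  proof -
    obtain w where w: "conj_quadratic w z = 0"
      using real_normed_field_quadratic_root by blast
    define y where "y = z - of_real (Re w)"
    have "y\<^sup>2 = of_real ((Re w)\<^sup>2) - of_real ((cmod w)\<^sup>2) + conj_quadratic w z"
      unfolding y_def conj_quadratic_def by (simp add: power2_eq_square algebra_simps)
    then have y2: "y\<^sup>2 = - of_real ((Im w)\<^sup>2)"
      unfolding w cmod_power2 by simp
    have y0: "y \<noteq> 0" using that unfolding y_def by (metis Reals_of_real eq_iff_diff_eq_0)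
    then have im: "Im w \<noteq> 0" using y2 by auto
    have "z = of_real (Re w) + of_real (Im w) * (y / of_real (Im w))"
      using im by (simp add: y_def)
    moreover have "(y / of_real (Im w))\<^sup>2 = -1"
      using im by (simp add: power_divide y2)
    ultimately show ?thesis by blast
  qed
  obtain j :: 'k where j: "j\<^sup>2 = -1" using False root by blast
  define h where "h c = of_real (Re c) + of_real (Im c) * j" for c
  have add: "h (c + d) = h c + h d" for c d by (simp add: h_def algebra_simps)
  have jj: "j * (j * x) = - x" for x
    using j by (metis mult.assoc mult_minus1 power2_eq_square)
  have mult: "h (c * d) = h c * h d" for c d
    by (simp add: h_def algebra_simps jj)
  have of_real: "h (of_real r) = of_real r" for r by (simp add: h_def)
  have one: "h 1 = 1" by (simp add: h_def)
  have pow: "h (c ^ n) = h c ^ n" for c n by (induction n) (auto simp: one mult)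
  have nj: "norm j = 1"
  proof -
    have "(norm j)\<^sup>2 = 1" by (simp add: norm_power[symmetric] j)
    then show ?thesis by (simp add: power2_eq_1_iff) (smt (verit) norm_ge_zero)
  qed
  have h2: "norm (h c) \<le> 2 * cmod c" for c
  proof -
    have "norm (h c) \<le> \<bar>Re c\<bar> + \<bar>Im c\<bar>"
      unfolding h_def by (rule norm_triangle_le) (simp add: norm_mult nj)
    then show ?thesis using abs_Re_le_cmod[of c] abs_Im_le_cmod[of c] by linarith
  qed
  \<comment> \<open>Multiplicativity removes the factor 2 of \<open>h2\<close>: applied to
    \<open>c ^ n\<close>, that bound keeps every power of \<open>norm (h c) / cmod c\<close> at most
    2, so the ratio is at most 1.\<close>
  have le: "norm (h c) \<le> cmod c" for c
  proof (rule ccontr)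
    assume "\<not> norm (h c) \<le> cmod c"
    moreover from this have c: "c \<noteq> 0" using h2[of c] by auto
    ultimately have "norm (h c) / cmod c > 1" by simp
    then obtain n where n: "(norm (h c) / cmod c) ^ n > 2"
      using real_arch_pow by blast
    have "norm (h c) ^ n \<le> 2 * cmod c ^ n"
      using h2[of "c ^ n"] by (simp add: pow norm_power)
    then show False using n c by (simp add: power_divide field_simps)
  qed
  have eq: "norm (h c) = cmod c" for c
  proof (cases "c = 0")
    case True
    then show ?thesis by (simp add: h_def)
  next
    case False
    \<comment> \<open>The reverse inequality is \<open>le\<close> at the inverse of
      \<open>c\<close>.\<close>
    have "norm (h c) * norm (h (inverse c)) = 1"
      using mult[of c "inverse c"] False one by (simp add: norm_mult[symmetric])
    moreover have "norm (h c) * norm (h (inverse c)) \<le> norm (h c) * inverse (cmod c)"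
      using le[of "inverse c"] by (intro mult_left_mono) (auto simp: norm_inverse)
    ultimately have "cmod c \<le> norm (h c)" using False by (simp add: field_simps)
    with le show ?thesis by (simp add: antisym)
  qed
  have "surj h"
  proof (rule surjI)
    show "h (SOME c. h c = z) = z" for z
    proof (rule someI_ex)
      show "\<exists>c. h c = z"
      proof (cases "z \<in> \<real>")
        case True
        then show ?thesis using of_real by (auto elim!: Reals_cases)
      next
        case False
        then obtain a b i where z: "z = of_real a + of_real b * i" "i\<^sup>2 = -1" using root by blast
        \<comment> \<open>The square root of -1 obtained from \<open>z\<close> may be
          \<open>- j\<close>; conjugating the argument of \<open>h\<close> absorbs the sign.\<close>
        have "i = j \<or> i = - j" using z(2) j by (metis power2_eq_iff)
        then have "h (Complex a b) = z \<or> h (Complex a (- b)) = z"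
          by (auto simp: h_def z(1))
        then show ?thesis by blast
      qed
    qed
  qed
  with eq add mult of_real show ?thesis by blast
qed auto

lemma parallelogram_law_real_normed_field:
  fixes a b :: "'k::real_normed_field"
  shows "(norm (a + b))\<^sup>2 + (norm (a - b))\<^sup>2 = 2 * (norm a)\<^sup>2 + 2 * (norm b)\<^sup>2"
  using real_normed_field_cases[where 'k = 'k]
proof
  assume R: "\<forall>z::'k. z \<in> \<real>"
  obtain r s where "a = of_real r" "b = of_real s"
    using R by (metis Reals_cases)
  then show ?thesis
    by (simp flip: of_real_add of_real_diff) (simp add: power2_eq_square algebra_simps)
next
  assume "\<exists>h :: complex \<Rightarrow> 'k. surj h \<and> (\<forall>c. norm (h c) = cmod c) \<and> (\<forall>c d. h (c + d) = h c + h d) \<and>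
      (\<forall>c d. h (c * d) = h c * h d) \<and> (\<forall>r. h (of_real r) = of_real r)"
  then obtain h :: "complex \<Rightarrow> 'k" where h: "surj h" "\<And>c. norm (h c) = cmod c" "\<And>c d. h (c + d) = h c + h d"
    by blast
  obtain c d where ab: "a = h c" "b = h d" using h(1) by (metis surjD)
  have "h c = h (c - d) + h d" by (simp flip: h(3))
  then have "h c - h d = h (c - d)" by (metis add_diff_cancel_right')
  then show ?thesis
    unfolding ab h(3)[symmetric] by (simp only: h(2) cmod_power2) (simp add: power2_eq_square algebra_simps)
qed

section \<open>The Hahn-Banach theorem\<close>

text \<open>The scalar multiplication is a parameter because the results are applied to a
  \<open>'k\<close>-space with scalars restricted to the reals.\<close>

definition sublinear :: "(real \<Rightarrow> 'v::ab_group_add \<Rightarrow> 'v) \<Rightarrow> ('v \<Rightarrow> real) \<Rightarrow> bool" where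
  "sublinear s p \<longleftrightarrow> (\<forall>x y. p (x + y) \<le> p x + p y) \<and> (\<forall>t\<ge>0. \<forall>x. p (s t x) = t * p x)"

context
  fixes s :: "real \<Rightarrow> 'v::ab_group_add \<Rightarrow> 'v"
  assumes vs: "vector_space s"
begin

interpretation vector_space s by (fact vs)

lemma sublinear_zero: "sublinear s p \<Longrightarrow> p 0 = 0"
  unfolding sublinear_def by (metis scale_zero_right order_refl mult_zero_left)

lemma sublinear_neg_le: "sublinear s p \<Longrightarrow> - p (- x) \<le> p x"
  using sublinear_zero[of p] unfolding sublinear_def
  by (metis add.right_inverse minus_le_iff neg_le_iff_le add_le_cancel_left diff_ge_0_iff_ge
      diff_minus_eq_add add.commute)

text \<open>Common tool for the three infima below: over a chain, along a ray and over a subspace.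
  The lower bound \<open>b\<close> keeps each infimum finite; in \<open>mult\<close> one inequality
  suffices, as the factor 1/t gives the other.\<close>

lemma sublinear_Inf:
  fixes T :: "'v \<Rightarrow> real set"
  assumes ne: "\<And>x. T x \<noteq> {}" and bd: "\<And>x a. a \<in> T x \<Longrightarrow> b x \<le> a"
    and add: "\<And>x y a c. a \<in> T x \<Longrightarrow> c \<in> T y \<Longrightarrow> \<exists>d\<in>T (x + y). d \<le> a + c"
    and mult: "\<And>x a t. a \<in> T x \<Longrightarrow> 0 < t \<Longrightarrow> \<exists>d\<in>T (s t x). d \<le> t * a"
    and zero: "\<exists>a\<in>T 0. a \<le> 0" "\<And>a. a \<in> T 0 \<Longrightarrow> 0 \<le> a"
  shows "sublinear s (\<lambda>x. Inf (T x))"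
proof -
  have bdd: "bdd_below (T x)" for x using bd by (meson bdd_below.I)
  have lower: "Inf (T x) \<le> a" if "a \<in> T x" for a x using that bdd by (rule cInf_lower)
  have sub: "Inf (T (x + y)) \<le> Inf (T x) + Inf (T y)" for x y
  proof -
    have "Inf (T (x + y)) - c \<le> a" if "a \<in> T x" "c \<in> T y" for a c
      using add[OF that] lower by (smt (verit, best))
    then have "Inf (T (x + y)) - c \<le> Inf (T x)" if "c \<in> T y" for c
      using that ne by (meson cInf_greatest)
    then have "Inf (T (x + y)) - Inf (T x) \<le> c" if "c \<in> T y" for c
      using that by (smt (verit, best))
    then have "Inf (T (x + y)) - Inf (T x) \<le> Inf (T y)" using ne by (meson cInf_greatest)
    then show ?thesis by simp
  qed
  have le: "Inf (T (s t x)) \<le> t * Inf (T x)" if "0 < t" for t x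
  proof -
    have "Inf (T (s t x)) / t \<le> a" if "a \<in> T x" for a
      using mult[OF that \<open>0 < t\<close>] lower \<open>0 < t\<close>
      by (metis order_trans pos_divide_le_eq mult.commute)
    then have "Inf (T (s t x)) / t \<le> Inf (T x)" using ne by (meson cInf_greatest)
    then show ?thesis using that by (simp add: field_simps)
  qed
  have z: "Inf (T 0) = 0"
    using zero lower ne by (meson antisym cInf_greatest order_trans)
  have "Inf (T (s t x)) = t * Inf (T x)" if "0 \<le> t" for t x
  proof (cases "t = 0")
    case False
    with that have t: "0 < t" by simp
    have "Inf (T x) \<le> inverse t * Inf (T (s t x))"
      using le[of "inverse t" "s t x"] t by simp
    with le[OF t] t show ?thesis by (intro antisym) (auto simp: field_simps)
  qed (simp add: z)
  with sub show ?thesis by (simp add: sublinear_def)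
qed

text \<open>A minimal sublinear functional \<open>f\<close> below \<open>p\<close>, found by Zorn's
  lemma, is additive: the infimum over t \<ge> 0 of f(x + t y) - t f(y) is sublinear and below
  \<open>f\<close>, hence equal to \<open>f\<close>, and t = 1 gives f(x) + f(y) \<le> f(x +
  y).\<close>

lemma exists_linear_below_sublinear:
  assumes p: "sublinear s p"
  shows "\<exists>f. (\<forall>x. f x \<le> p x) \<and> (\<forall>x y. f (x + y) = f x + f y) \<and> (\<forall>t x. f (s t x) = t * f x)"
proof -
  define A where "A = {g. sublinear s g \<and> (\<forall>x. g x \<le> p x)}"
  \<comment> \<open>The order is reversed because \<open>predicate_Zorn\<close> yields maximal
    elements.\<close>
  define R where "R = (\<lambda>g h :: 'v \<Rightarrow> real. \<forall>x. h x \<le> g x)"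
  have "\<exists>m\<in>A. \<forall>a\<in>A. R m a \<longrightarrow> a = m"
  proof (rule predicate_Zorn)
    show "partial_order_on A (relation_of R A)"
      by (auto simp: partial_order_on_def preorder_on_def refl_on_def trans_def antisym_def
          relation_of_def R_def fun_eq_iff intro: order_trans antisym)
    fix C assume C: "C \<in> Chains (relation_of R A)"
    show "\<exists>u\<in>A. \<forall>a\<in>C. R a u"
    proof (cases "C = {}")
      case True
      then show ?thesis using p by (auto simp: A_def)
    next
      case False
      have CA: "g \<in> A" if "g \<in> C" for g using C that by (auto simp: Chains_def relation_of_def)
      have ch: "R g h \<or> R h g" if "g \<in> C" "h \<in> C" for g h
        using C that by (auto simp: Chains_def relation_of_def)
      have sl: "sublinear s g" "g x \<le> p x" if "g \<in> C" for g x using CA[OF that] by (auto simp: A_def)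
      have lb: "- p (- x) \<le> g x" if "g \<in> C" for g x
        using sublinear_neg_le[OF sl(1)[OF that], of x] sl(2)[OF that, of "- x"] by linarith
      define u where "u = (\<lambda>x. Inf ((\<lambda>g. g x) ` C))"
      have "sublinear s u"
        unfolding u_def
      proof (rule sublinear_Inf)
        fix x y a c assume "a \<in> (\<lambda>g. g x) ` C" "c \<in> (\<lambda>g. g y) ` C"
        then obtain g h where gh: "g \<in> C" "h \<in> C" "a = g x" "c = h y" by auto
        have "g (x + y) \<le> g x + g y" "h (x + y) \<le> h x + h y"
          using sl(1)[OF gh(1)] sl(1)[OF gh(2)] by (auto simp: sublinear_def)
        \<comment> \<open>In a chain one of \<open>g\<close> and \<open>h\<close> lies below the
          other, and the smaller one serves at x + y.\<close>
        then have "g (x + y) \<le> a + c \<or> h (x + y) \<le> a + c"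
          using ch[OF gh(1,2)] unfolding gh(3,4) R_def by (smt (verit))
        then show "\<exists>d\<in>(\<lambda>g. g (x + y)) ` C. d \<le> a + c" using gh by auto
      next
        fix x a and t :: real assume "a \<in> (\<lambda>g. g x) ` C" "0 < t"
        then show "\<exists>d\<in>(\<lambda>g. g (s t x)) ` C. d \<le> t * a"
          using sl(1) by (fastforce simp: sublinear_def)
      next
        show "\<exists>a\<in>(\<lambda>g. g 0) ` C. a \<le> 0" using False sl(1) sublinear_zero by fastforce
        show "\<And>a. a \<in> (\<lambda>g. g 0) ` C \<Longrightarrow> 0 \<le> a" using sl(1) sublinear_zero by fastforce
        show "\<And>x a. a \<in> (\<lambda>g. g x) ` C \<Longrightarrow> - p (- x) \<le> a" using lb by auto
      qed (use False in auto)
      moreover have ug: "u x \<le> g x" if "g \<in> C" for g x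
        unfolding u_def by (rule cInf_lower) (use that lb in \<open>auto intro!: bdd_belowI\<close>)
      moreover have "u x \<le> p x" for x
        using False ug sl(2) by (meson all_not_in_conv order_trans)
      ultimately show ?thesis by (auto simp: A_def R_def)
    qed
  qed
  then obtain f where fA: "f \<in> A" and fmin: "\<And>g. g \<in> A \<Longrightarrow> R f g \<Longrightarrow> g = f" by blast
  have f: "sublinear s f" "\<And>x. f x \<le> p x" using fA by (auto simp: A_def)
  have min: "g = f" if "sublinear s g" "\<And>x. g x \<le> f x" for g
    by (rule fmin) (use that f(2) in \<open>auto simp: A_def R_def intro: order_trans\<close>)
  have sub: "f (x + y) \<le> f x + f y" and hom: "0 \<le> t \<Longrightarrow> f (s t x) = t * f x" for x y t
    using f(1) by (auto simp: sublinear_def)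
  have super: "f x + f y \<le> f (x + y)" for x y
  proof -
    define T where "T x = (\<lambda>t. f (x + s t y) - t * f y) ` {0..}" for x
    have lb: "- f (- x) \<le> f (x + s t y) - t * f y" if "0 \<le> t" for x t
      using sub[of "x + s t y" "- x"] hom[OF that, of y] by simp
    have "sublinear s (\<lambda>x. Inf (T x))"
    proof (rule sublinear_Inf)
      fix u v a c assume "a \<in> T u" "c \<in> T v"
      then obtain t r where tr: "0 \<le> t" "0 \<le> r" "a = f (u + s t y) - t * f y" "c = f (v + s r y) - r * f y"
        by (auto simp: T_def)
      have "f ((u + v) + s (t + r) y) - (t + r) * f y \<le> a + c"
        using sub[of "u + s t y" "v + s r y"] by (simp add: tr algebra_simps)
      moreover have "f ((u + v) + s (t + r) y) - (t + r) * f y \<in> T (u + v)"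
        using tr unfolding T_def by (intro imageI) simp
      ultimately show "\<exists>d\<in>T (u + v). d \<le> a + c" by blast
    next
      fix x a and t :: real assume "a \<in> T x" "0 < t"
      then obtain r where r: "0 \<le> r" "a = f (x + s r y) - r * f y" by (auto simp: T_def)
      have "t * a = f (s t x + s (t * r) y) - (t * r) * f y"
        using hom[of t "x + s r y"] \<open>0 < t\<close> by (simp add: r algebra_simps)
      moreover have "f (s t x + s (t * r) y) - (t * r) * f y \<in> T (s t x)"
        using r \<open>0 < t\<close> unfolding T_def by (intro imageI) simp
      ultimately show "\<exists>d\<in>T (s t x). d \<le> t * a" by (metis order_refl)
    next
      show "\<exists>a\<in>T 0. a \<le> 0"
        by (rule bexI[of _ "f (0 + s 0 y) - 0 * f y"]) (auto simp: T_def sublinear_zero[OF f(1)] intro!: image_eqI[of _ _ 0])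
      show "0 \<le> a" if "a \<in> T 0" for a using that lb[of _ 0] by (auto simp: T_def sublinear_zero[OF f(1)])
      show "- f (- x) \<le> a" if "a \<in> T x" for x a using that lb by (auto simp: T_def)
    qed (auto simp: T_def)
    moreover have low: "Inf (T x) \<le> f (x + s t y) - t * f y" if "0 \<le> t" for x t
      unfolding T_def by (rule cInf_lower) (use that lb in \<open>auto intro!: bdd_belowI\<close>)
    moreover have "Inf (T x) \<le> f x" for x using low[of 0 x] by simp
    ultimately have "(\<lambda>x. Inf (T x)) = f" by (intro min) auto
    then show ?thesis using low[of 1 x] by (auto dest: fun_cong[of _ _ x])
  qed
  have add: "f (x + y) = f x + f y" for x y using sub super by (rule antisym)
  have neg: "f (- x) = - f x" for x
    using add[of x "- x"] sublinear_zero[OF f(1)] by simp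
  have "f (s t x) = t * f x" for t x
  proof (cases "0 \<le> t")
    case False
    then have "f (s (- t) x) = - t * f x" by (intro hom) simp
    then show ?thesis using neg[of "s t x"] by simp
  qed (rule hom)
  with add f(2) show ?thesis by blast
qed

text \<open>The infimum q(x) of p(x - y) + f(y) over y in \<open>S\<close> is sublinear, below
  \<open>p\<close> everywhere and below \<open>f\<close> on \<open>S\<close>. A linear
  \<open>g\<close> below \<open>q\<close> therefore satisfies g \<le> f on \<open>S\<close>, and
  equality follows by passing to -x.\<close>

theorem real_Hahn_Banach:
  assumes p: "sublinear s p" and S: "subspace S"
    and f_add: "\<And>x y. x \<in> S \<Longrightarrow> y \<in> S \<Longrightarrow> f (x + y) = f x + f y"
    and f_scale: "\<And>t x. x \<in> S \<Longrightarrow> f (s t x) = t * f x"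
    and f_le: "\<And>x. x \<in> S \<Longrightarrow> f x \<le> p x"
  shows "\<exists>g. (\<forall>x. g x \<le> p x) \<and> (\<forall>x\<in>S. g x = f x) \<and> (\<forall>x y. g (x + y) = g x + g y) \<and>
             (\<forall>t x. g (s t x) = t * g x)"
proof -
  have sub: "p (x + y) \<le> p x + p y" and hom: "0 \<le> t \<Longrightarrow> p (s t x) = t * p x" for x y t
    using p by (auto simp: sublinear_def)
  have f_neg: "f (- x) = - f x" if "x \<in> S" for x using f_scale[OF that, of "- 1"] by simp
  have f_zero: "f 0 = 0" using f_scale[of 0 0] subspace_0[OF S] by simp
  define T where "T x = (\<lambda>y. p (x - y) + f y) ` S" for x
  have lb: "- p (- x) \<le> p (x - y) + f y" if "y \<in> S" for x y
    using sub[of "x - y" "- x"] f_le[of "- y"] f_neg[OF that] subspace_neg[OF S that] by simp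
  define q where "q x = Inf (T x)" for x
  have "sublinear s q"
    unfolding q_def
  proof (rule sublinear_Inf)
    fix x y a c assume "a \<in> T x" "c \<in> T y"
    then obtain u v where uv: "u \<in> S" "v \<in> S" "a = p (x - u) + f u" "c = p (y - v) + f v"
      by (auto simp: T_def)
    have "p ((x + y) - (u + v)) + f (u + v) \<le> a + c"
      using sub[of "x - u" "y - v"] uv by (simp add: f_add algebra_simps)
    moreover have "p ((x + y) - (u + v)) + f (u + v) \<in> T (x + y)"
      using uv subspace_add[OF S] unfolding T_def by (intro imageI) simp
    ultimately show "\<exists>d\<in>T (x + y). d \<le> a + c" by blast
  next
    fix x a and t :: real assume "a \<in> T x" "0 < t"
    then obtain u where u: "u \<in> S" "a = p (x - u) + f u" by (auto simp: T_def)
    have "t * a = p (s t x - s t u) + f (s t u)"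
      using hom[of t "x - u"] \<open>0 < t\<close> u by (simp add: f_scale scale_right_diff_distrib algebra_simps)
    moreover have "p (s t x - s t u) + f (s t u) \<in> T (s t x)"
      using u subspace_scale[OF S] unfolding T_def by (intro imageI) simp
    ultimately show "\<exists>d\<in>T (s t x). d \<le> t * a" by (metis order_refl)
  next
    show "\<exists>a\<in>T 0. a \<le> 0"
      by (rule bexI[of _ "p (0 - 0) + f 0"])
         (use subspace_0[OF S] in \<open>auto simp: T_def f_zero sublinear_zero[OF p] intro!: image_eqI[of _ _ 0]\<close>)
    show "0 \<le> a" if "a \<in> T 0" for a using that lb[of _ 0] by (auto simp: T_def sublinear_zero[OF p])
    show "- p (- x) \<le> a" if "a \<in> T x" for x a using that lb by (auto simp: T_def)
  qed (use subspace_0[OF S] in \<open>auto simp: T_def\<close>)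
  then obtain g where g: "\<And>x. g x \<le> q x" "\<And>x y. g (x + y) = g x + g y" "\<And>t x. g (s t x) = t * g x"
    using exists_linear_below_sublinear by blast
  have low: "q x \<le> p (x - y) + f y" if "y \<in> S" for x y
    unfolding q_def T_def by (rule cInf_lower) (use that lb in \<open>auto intro!: bdd_belowI\<close>)
  have gp: "g x \<le> p x" for x
    using g(1)[of x] low[OF subspace_0[OF S], of x] f_zero by simp
  have gf: "g x \<le> f x" if "x \<in> S" for x
    using g(1)[of x] low[OF that, of x] sublinear_zero[OF p] by simp
  have "g x = f x" if "x \<in> S" for x
    using gf[OF that] gf[OF subspace_neg[OF S that]] f_neg[OF that] g(3)[of "- 1" x] by simp
  with gp g show ?thesis by blast
qed

end

text \<open>The constant 2 is an artefact of bounding the real and imaginary parts separately.\<close>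

theorem Hahn_Banach_seminorm:
  fixes sm :: "'k::real_normed_field \<Rightarrow> 'v::ab_group_add \<Rightarrow> 'v" and f :: "'v \<Rightarrow> 'k"
  assumes vs: "vector_space sm" and p: "seminorm sm p" and S: "module.subspace sm S"
    and f_add: "\<And>x y. x \<in> S \<Longrightarrow> y \<in> S \<Longrightarrow> f (x + y) = f x + f y"
    and f_scale: "\<And>c x. x \<in> S \<Longrightarrow> f (sm c x) = c * f x"
    and f_le: "\<And>x. x \<in> S \<Longrightarrow> norm (f x) \<le> p x"
  obtains g where "Vector_Spaces.linear sm (*) g" "\<And>x. x \<in> S \<Longrightarrow> g x = f x" "\<And>x. norm (g x) \<le> 2 * p x"
proof -
  interpret vector_space sm by (fact vs)
  define s where "s = (\<lambda>r. sm (of_real r))"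
  have vs': "vector_space s"
    by unfold_locales (auto simp: s_def algebra_simps)
  have p_scale: "p (sm c x) = norm c * p x" for c x using p by (simp add: seminorm_def)
  have sub: "sublinear s p" using p by (simp add: sublinear_def seminorm_def s_def)
  have S': "module.subspace s S"
    using S vs' by (auto simp: subspace_def module.subspace_def module_iff_vector_space s_def)
  have linI: "Vector_Spaces.linear sm (*) g"
    if "\<And>x y. g (x + y) = g x + g y" "\<And>c x. g (sm c x) = c * g x" for g :: "'v \<Rightarrow> 'k"
    using that by unfold_locales (auto simp: algebra_simps)
  \<comment> \<open>\<open>\<phi>\<close> will be the inverse of \<open>of_real\<close> in the real
    case and the real part in the complex case. The two-sided bound on \<open>g\<close> comes from
    p(-x) = p(x).\<close>
  have real_ext: "\<exists>g. (\<forall>x. \<bar>g x\<bar> \<le> p x) \<and> (\<forall>x\<in>S. g x = \<phi> (f x)) \<and> (\<forall>x y. g (x + y) = g x + g y) \<and>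
             (\<forall>t x. g (s t x) = t * g x)"
    if "\<And>a b. \<phi> (a + b) = \<phi> a + \<phi> b" "\<And>t a. \<phi> (of_real t * a) = t * \<phi> a" "\<And>a. \<bar>\<phi> a\<bar> \<le> norm a"
    for \<phi> :: "'k \<Rightarrow> real"
  proof -
    have "\<phi> (f x) \<le> p x" if "x \<in> S" for x
      using f_le[OF that] \<open>\<bar>\<phi> (f x)\<bar> \<le> norm (f x)\<close> by linarith
    then have "\<exists>g. (\<forall>x. g x \<le> p x) \<and> (\<forall>x\<in>S. g x = \<phi> (f x)) \<and> (\<forall>x y. g (x + y) = g x + g y) \<and>
             (\<forall>t x. g (s t x) = t * g x)"
      by (intro real_Hahn_Banach[OF vs' sub S']) (auto simp: f_add f_scale that s_def)
    then obtain g where g: "\<forall>x. g x \<le> p x" "\<forall>x\<in>S. g x = \<phi> (f x)" "\<forall>x y. g (x + y) = g x + g y"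
             "\<forall>t x. g (s t x) = t * g x" by blast
    have "\<bar>g x\<bar> \<le> p x" for x
      using g(1)[rule_format, of x] g(1)[rule_format, of "sm (-1) x"] g(4)[rule_format, of "-1" x] p_scale[of "-1" x]
      by (simp add: s_def)
    with g show ?thesis by blast
  qed
  show thesis
    using real_normed_field_cases[where 'k = 'k]
  proof
    assume R: "\<forall>z::'k. z \<in> \<real>"
    define \<phi> :: "'k \<Rightarrow> real" where "\<phi> = inv of_real"
    have of_phi: "of_real (\<phi> z) = z" for z
      unfolding \<phi>_def by (rule f_inv_into_f) (use R in \<open>simp add: Reals_def\<close>)
    have phi_of: "\<phi> (of_real r) = r" for r
      unfolding \<phi>_def by (rule inv_f_f) (simp add: inj_def)
    have "\<exists>g. (\<forall>x. \<bar>g x\<bar> \<le> p x) \<and> (\<forall>x\<in>S. g x = \<phi> (f x)) \<and> (\<forall>x y. g (x + y) = g x + g y) \<and>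
             (\<forall>t x. g (s t x) = t * g x)"
    proof (rule real_ext)
      show "\<phi> (a + b) = \<phi> a + \<phi> b" for a b by (metis of_phi phi_of of_real_add)
      show "\<phi> (of_real t * a) = t * \<phi> a" for a t by (metis of_phi phi_of of_real_mult)
      show "\<bar>\<phi> a\<bar> \<le> norm a" for a by (metis of_phi norm_of_real order_refl)
    qed
    then obtain g where g: "\<And>x. \<bar>g x\<bar> \<le> p x" "\<And>x. x \<in> S \<Longrightarrow> g x = \<phi> (f x)" "\<And>x y. g (x + y) = g x + g y"
        "\<And>t x. g (s t x) = t * g x" by blast
    show thesis
    proof (rule that[of "\<lambda>x. of_real (g x)"])
      show "Vector_Spaces.linear sm (*) (\<lambda>x. of_real (g x))"
      proof (rule linI)
        show "of_real (g (sm c x)) = c * of_real (g x)" for c x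
          using g(4)[of "\<phi> c" x] of_phi by (simp add: s_def)
      qed (simp add: g)
      show "norm (of_real (g x) :: 'k) \<le> 2 * p x" for x using g(1)[of x] by simp
    qed (simp add: g of_phi)
  next
    assume "\<exists>h :: complex \<Rightarrow> 'k. surj h \<and> (\<forall>c. norm (h c) = cmod c) \<and> (\<forall>c d. h (c + d) = h c + h d) \<and>
      (\<forall>c d. h (c * d) = h c * h d) \<and> (\<forall>r. h (of_real r) = of_real r)"
    then obtain h :: "complex \<Rightarrow> 'k" where h: "surj h" "\<And>c. norm (h c) = cmod c" "\<And>c d. h (c + d) = h c + h d"
      "\<And>c d. h (c * d) = h c * h d" "\<And>r. h (of_real r) = of_real r" by blast
    define k where "k = inv h"
    have hk: "h (k z) = z" for z unfolding k_def using h(1) by (rule surj_f_inv_f)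
    have "inj h"
    proof (rule injI)
      fix c d assume "h c = h d"
      then have "h (c - d) = 0" using h(3)[of "c - d" d] by simp
      then show "c = d" using h(2)[of "c - d"] by simp
    qed
    then have kh: "k (h c) = c" for c unfolding k_def by simp
    define \<phi> where "\<phi> z = Re (k z)" for z
    have "\<exists>g. (\<forall>x. \<bar>g x\<bar> \<le> p x) \<and> (\<forall>x\<in>S. g x = \<phi> (f x)) \<and> (\<forall>x y. g (x + y) = g x + g y) \<and>
             (\<forall>t x. g (s t x) = t * g x)"
    proof (rule real_ext)
      have "k (a + b) = k a + k b" for a b by (metis hk kh h(3))
      then show "\<phi> (a + b) = \<phi> a + \<phi> b" for a b by (simp add: \<phi>_def)
      have "k (of_real t * a) = of_real t * k a" for a t by (metis hk kh h(4,5))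
      then show "\<phi> (of_real t * a) = t * \<phi> a" for a t by (simp add: \<phi>_def)
      show "\<bar>\<phi> a\<bar> \<le> norm a" for a unfolding \<phi>_def by (metis abs_Re_le_cmod h(2) hk)
    qed
    then obtain g where g: "\<And>x. \<bar>g x\<bar> \<le> p x" "\<And>x. x \<in> S \<Longrightarrow> g x = \<phi> (f x)" "\<And>x y. g (x + y) = g x + g y"
        "\<And>t x. g (s t x) = t * g x" by blast
    define j where "j = h \<i>"
    have j: "j * j = -1" using h(4)[of \<i> \<i>] h(5)[of "-1"] by (simp add: j_def)
    have nj: "norm j = 1" by (simp add: j_def h(2))
    \<comment> \<open>The standard complexification: \<open>g\<close> extends the real part of
      \<open>f\<close>, and \<open>- g (sm j x)\<close> supplies the imaginary part of the
      extension.\<close>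
    define G where "G x = of_real (g x) - j * of_real (g (sm j x))" for x
    have hc: "h c = of_real (Re c) + j * of_real (Im c)" for c
      by (metis complex_eq h(3,4,5) j_def)
    have G_add: "G (x + y) = G x + G y" for x y
      by (simp add: G_def g(3) algebra_simps)
    have G_real: "G (s r x) = of_real r * G x" for r x
    proof -
      have "sm j (s r x) = s r (sm j x)" by (simp add: s_def mult.commute)
      then show ?thesis by (simp add: G_def g(4) algebra_simps)
    qed
    have G_j: "G (sm j x) = j * G x" for x
    proof -
      have "sm j (sm j x) = s (-1) x" by (simp add: s_def j)
      then show ?thesis using j by (simp add: G_def g(4) right_diff_distrib flip: mult.assoc)
    qed
    show thesis
    proof (rule that[of G])
      show "Vector_Spaces.linear sm (*) G"
      proof (rule linI[OF G_add])
        fix c x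
        have c: "c = of_real (Re (k c)) + j * of_real (Im (k c))" using hc[of "k c"] by (simp add: hk)
        have "sm c x = s (Re (k c)) x + sm j (s (Im (k c)) x)"
          by (subst c) (simp add: s_def scale_left_distrib)
        then show "G (sm c x) = c * G x"
          by (subst c) (simp add: G_add G_j G_real algebra_simps)
      qed
      show "norm (G x) \<le> 2 * p x" for x
      proof -
        have "norm (G x) \<le> \<bar>g x\<bar> + \<bar>g (sm j x)\<bar>"
          unfolding G_def by (rule norm_triangle_le_diff) (simp add: norm_mult nj)
        then show ?thesis using g(1)[of x] g(1)[of "sm j x"] p_scale[of j x] nj by simp
      qed
      show "G x = f x" if x: "x \<in> S" for x
      proof -
        have jx: "sm j x \<in> S" using S x by (rule subspace_scale)
        \<comment> \<open>The real part of i f(x) is minus the imaginary part of f(x), so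
          \<open>G\<close> recovers \<open>f\<close> on \<open>S\<close>.\<close>
        have "k (j * f x) = \<i> * k (f x)" by (metis hk kh h(4) j_def)
        then have "g (sm j x) = - Im (k (f x))" by (simp add: g(2)[OF jx] f_scale[OF x] \<phi>_def)
        then show ?thesis using hc[of "k (f x)"] by (simp add: G_def g(2)[OF x] \<phi>_def hk)
      qed
    qed
  qed
qed

section \<open>Rademacher means\<close>

text \<open>The mean of \<open>p\<close> over the sums of \<open>x\<close> and the signed terms
  \<open>u 0\<close>, ..., \<open>u (n - 1)\<close>, for all 2^n choices of signs. The offset
  \<open>x\<close> collects the terms whose signs are already fixed; the inductions generalise over
  it.\<close>

fun rademacher_mean :: "('v::ab_group_add \<Rightarrow> real) \<Rightarrow> (nat \<Rightarrow> 'v) \<Rightarrow> nat \<Rightarrow> 'v \<Rightarrow> real" where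
  "rademacher_mean p u 0 x = p x"
| "rademacher_mean p u (Suc n) x = (rademacher_mean p u n (x + u n) + rademacher_mean p u n (x - u n)) / 2"

lemma rademacher_mean_add_le:
  assumes "\<And>x y. p (x + y) \<le> p x + p y"
  shows "rademacher_mean p (\<lambda>k. u k + v k) n (x + y) \<le> rademacher_mean p u n x + rademacher_mean p v n y"
proof (induction n arbitrary: x y)
  case 0
  show ?case using assms by simp
next
  case (Suc n)
  have eq: "x + y + (u n + v n) = (x + u n) + (y + v n)" "x + y - (u n + v n) = (x - u n) + (y - v n)"
    by (auto simp: algebra_simps)
  have mean: "(a + a') / 2 \<le> (b + b') / 2 + (c + c') / 2" if "a \<le> b + c" "a' \<le> b' + c'" for a a' b b' c c' :: real
    using that by argo
  show ?case
    unfolding rademacher_mean.simps eq by (intro mean Suc)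
qed

lemma rademacher_mean_scale:
  assumes "vector_space sm" "seminorm sm p"
  shows "rademacher_mean p (\<lambda>k. sm c (u k)) n (sm c x) = norm c * rademacher_mean p u n x"
proof (induction n arbitrary: x)
  case 0
  show ?case using assms(2) by (simp add: seminorm_def)
next
  case (Suc n)
  interpret vector_space sm by fact
  show ?case using Suc[of "x + u n"] Suc[of "x - u n"]
    by (simp add: scale_right_distrib scale_right_diff_distrib distrib_left)
qed

text \<open>Reduces sequences of multiples of one vector to means of scalars, where the
  parallelogram law applies.\<close>

lemma rademacher_mean_scale_vector:
  assumes "vector_space sm" "seminorm sm p"
  shows "rademacher_mean p (\<lambda>k. sm (c k) x) n (sm d x) = rademacher_mean norm c n d * p x"
proof (induction n arbitrary: d)
  case 0
  show ?case using assms(2) by (simp add: seminorm_def)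
next
  case (Suc n)
  interpret vector_space sm by fact
  show ?case using Suc[of "d + c n"] Suc[of "d - c n"]
    by (simp add: scale_left_distrib scale_left_diff_distrib distrib_right)
qed

text \<open>Makes the mean of a finitely supported sequence independent of the cutoff, so that
  sequences of different degrees can be compared at a common one.\<close>

lemma rademacher_mean_stable:
  assumes "n \<le> N" "\<And>k. n \<le> k \<Longrightarrow> u k = 0"
  shows "rademacher_mean p u N x = rademacher_mean p u n x"
  using assms by (induction N arbitrary: x rule: dec_induct) auto

text \<open>The first moment of a Rademacher sum is at most the root of its second moment. In the
  induction the mean of two roots is at most the root of the mean, and the parallelogram law
  evaluates the mean of the squared norms of \<open>d + c n\<close> and
  \<open>d - c n\<close>.\<close>

lemma rademacher_mean_norm_le:
  fixes c :: "nat \<Rightarrow> 'k::real_normed_field"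
  shows "rademacher_mean norm c n d \<le> sqrt ((norm d)\<^sup>2 + (\<Sum>k<n. (norm (c k))\<^sup>2))"
proof (induction n arbitrary: d)
  case (Suc n)
  define S where "S = (\<Sum>k<n. (norm (c k))\<^sup>2)"
  define X where "X = (norm (d + c n))\<^sup>2 + S"
  define Y where "Y = (norm (d - c n))\<^sup>2 + S"
  have nn: "0 \<le> X" "0 \<le> Y" by (auto simp: X_def Y_def S_def sum_nonneg)
  have "rademacher_mean norm c (Suc n) d \<le> (sqrt X + sqrt Y) / 2"
    using Suc[of "d + c n"] Suc[of "d - c n"] by (simp add: X_def Y_def S_def)
  also have "\<dots> \<le> sqrt ((X + Y) / 2)"
  proof (rule real_le_rsqrt)
    have "0 \<le> (sqrt X - sqrt Y)\<^sup>2" by simp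
    then show "((sqrt X + sqrt Y) / 2)\<^sup>2 \<le> (X + Y) / 2"
      using nn by (simp add: power2_eq_square field_simps)
  qed
  also have "(X + Y) / 2 = (norm d)\<^sup>2 + (\<Sum>k<Suc n. (norm (c k))\<^sup>2)"
    using parallelogram_law_real_normed_field[of d "c n"] by (simp add: X_def Y_def S_def)
  finally show ?case .
qed simp

text \<open>By the triangle inequality, averaging over the sign of \<open>u n\<close> does not lower
  the coordinates m > n of the offset, while coordinate n is traded for the diagonal entry
  \<open>r (u n) n\<close>. At n = N only the diagonal sum remains.\<close>

lemma sum_diagonal_le_rademacher_mean:
  fixes r :: "'v::ab_group_add \<Rightarrow> nat \<Rightarrow> 'k::real_normed_field"
  assumes S: "\<And>x y. x \<in> S \<Longrightarrow> y \<in> S \<Longrightarrow> x + y \<in> S" "\<And>x y. x \<in> S \<Longrightarrow> y \<in> S \<Longrightarrow> x - y \<in> S"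
    and r: "\<And>x y m. x \<in> S \<Longrightarrow> y \<in> S \<Longrightarrow> r (x + y) m = r x m + r y m"
    and le: "\<And>x. x \<in> S \<Longrightarrow> (\<Sum>m<N. norm (r x m)) \<le> p x"
    and u: "\<And>k. u k \<in> S" and "n \<le> N" and "x \<in> S"
  shows "(\<Sum>m=n..<N. norm (r x m)) + (\<Sum>m<n. norm (r (u m) m)) \<le> rademacher_mean p u n x"
  using \<open>n \<le> N\<close> \<open>x \<in> S\<close>
proof (induction n arbitrary: x)
  case 0
  then show ?case using le[of x] by (simp add: atLeast0LessThan)
next
  case (Suc n)
  have rdiff: "r (x - u n) m = r x m - r (u n) m" for m
    using r[OF S(2)[OF Suc.prems(2) u[of n]] u[of n], of m] by (simp add: algebra_simps)
  have two: "2 * norm a \<le> norm (a + b) + norm (a - b)" "2 * norm b \<le> norm (a + b) + norm (a - b)" for a b :: 'k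
  proof -
    have "norm (2 * a) = norm ((a + b) + (a - b))" "norm (2 * b) = norm ((a + b) - (a - b))"
      by (simp_all add: algebra_simps)
    then show "2 * norm a \<le> norm (a + b) + norm (a - b)" "2 * norm b \<le> norm (a + b) + norm (a - b)"
      using norm_triangle_ineq[of "a + b" "a - b"] norm_triangle_ineq4[of "a + b" "a - b"]
      by (simp_all add: norm_mult)
  qed
  have split: "(\<Sum>m=n..<N. f m) = f n + (\<Sum>m=Suc n..<N. f m)" for f :: "nat \<Rightarrow> real"
    using Suc.prems by (simp add: sum.atLeast_Suc_lessThan)
  have "2 * ((\<Sum>m=Suc n..<N. norm (r x m)) + norm (r (u n) n))
      \<le> (\<Sum>m=Suc n..<N. norm (r (x + u n) m) + norm (r (x - u n) m)) + (norm (r (x + u n) n) + norm (r (x - u n) n))"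
    unfolding distrib_left sum_distrib_left rdiff
    using two r[OF Suc.prems(2) u] by (intro add_mono sum_mono) auto
  also have "\<dots> = (\<Sum>m=n..<N. norm (r (x + u n) m)) + (\<Sum>m=n..<N. norm (r (x - u n) m))"
    by (simp add: split sum.distrib)
  finally show ?case
    using Suc.IH[OF _ S(1)[OF Suc.prems(2) u[of n]]] Suc.IH[OF _ S(2)[OF Suc.prems(2) u[of n]]] Suc.prems by simp
qed

section \<open>Seminorms and the space of finitely supported sequences\<close>

lemma seminorm_nonneg:
  fixes sm :: "'k::real_normed_field \<Rightarrow> 'a::ab_group_add \<Rightarrow> 'a"
  assumes "vector_space sm" "seminorm sm p"
  shows "0 \<le> p x"
proof -
  interpret vector_space sm by fact
  have sub: "p (y + z) \<le> p y + p z" and scale: "p (sm c y) = norm c * p y" for c y z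
    using assms(2) by (auto simp: seminorm_def)
  show ?thesis using sub[of x "sm (-1) x"] scale[of "-1" x] scale[of 0 x] by simp
qed

lemma seminorm_scaled_sum:
  fixes sm :: "'k::real_normed_field \<Rightarrow> 'a::ab_group_add \<Rightarrow> 'a"
  assumes "0 \<le> C" "\<And>i. seminorm sm (P i)"
  shows "seminorm sm (\<lambda>x. C * (\<Sum>i\<in>I. P i x))"
proof -
  have sub: "(\<Sum>i\<in>I. P i (x + y)) \<le> (\<Sum>i\<in>I. P i x) + (\<Sum>i\<in>I. P i y)" for x y
    using assms(2) by (auto simp: seminorm_def sum.distrib[symmetric] intro!: sum_mono)
  have "C * (\<Sum>i\<in>I. P i (x + y)) \<le> C * (\<Sum>i\<in>I. P i x) + C * (\<Sum>i\<in>I. P i y)" for x y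
    using mult_left_mono[OF sub assms(1)] by (simp add: distrib_left)
  moreover have "(\<Sum>i\<in>I. P i (sm c x)) = norm c * (\<Sum>i\<in>I. P i x)" for c x
    using assms(2) by (simp add: seminorm_def sum_distrib_left)
  ultimately show ?thesis by (simp add: seminorm_def mult.left_commute)
qed

text \<open>Polynomials with coefficients in \<open>'a\<close> serve as the space of finitely supported sequences in \<open>'a\<close>.\<close>

lemma vector_space_map_poly:
  assumes "vector_space sm"
  shows "vector_space (\<lambda>c. map_poly (sm c))"
proof -
  interpret vector_space sm by fact
  show ?thesis
    by unfold_locales (auto intro!: poly_eqI simp: coeff_map_poly scale_right_distrib scale_left_distrib)
qed

definition rademacher_seminorm :: "('a::ab_group_add \<Rightarrow> real) \<Rightarrow> 'a poly \<Rightarrow> real" where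
  "rademacher_seminorm p u = rademacher_mean p (coeff u) (Suc (degree u)) 0"

lemma rademacher_seminorm_eq:
  "degree u < n \<Longrightarrow> rademacher_seminorm p u = rademacher_mean p (coeff u) n 0"
  unfolding rademacher_seminorm_def
  by (rule rademacher_mean_stable[symmetric]) (auto intro: coeff_eq_0)

lemma seminorm_rademacher:
  assumes vs: "vector_space sm" and p: "seminorm sm p"
  shows "seminorm (\<lambda>c. map_poly (sm c)) (rademacher_seminorm p)"
  unfolding seminorm_def
proof (intro conjI allI)
  fix u v :: "'b poly"
  define n where "n = Suc (max (degree u) (degree v))"
  have n: "degree u < n" "degree v < n" "degree (u + v) < n"
    using degree_add_le_max[of u v] by (auto simp: n_def)
  have c: "coeff (u + v) = (\<lambda>k. coeff u k + coeff v k)" by auto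
  show "rademacher_seminorm p (u + v) \<le> rademacher_seminorm p u + rademacher_seminorm p v"
    unfolding n[THEN rademacher_seminorm_eq] c
    using rademacher_mean_add_le[of p "coeff u" "coeff v" n 0 0] p by (simp add: seminorm_def)
next
  interpret vector_space sm by fact
  fix c and u :: "'b poly"
  define n where "n = Suc (degree u)"
  have n: "degree u < n" "degree (map_poly (sm c) u) < n"
    using map_poly_degree_leq[of "sm c" u] by (auto simp: n_def)
  have c: "coeff (map_poly (sm c) u) = (\<lambda>k. sm c (coeff u k))" by (auto simp: coeff_map_poly)
  show "rademacher_seminorm p (map_poly (sm c) u) = norm c * rademacher_seminorm p u"
    unfolding n[THEN rademacher_seminorm_eq] c
    using rademacher_mean_scale[OF vs p, of c "coeff u" n 0] by simp
qed

text \<open>The last estimate is weak 2-summability in dual form: all finite combinations of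
  \<open>ch\<close> with coefficients in the unit ball of l_2 are dominated by one continuous
  seminorm.\<close>

lemma l1_basis_biorthogonal_sequence:
  fixes sm :: "'k::real_normed_field \<Rightarrow> 'a::ab_group_add \<Rightarrow> 'a"
  assumes lcs: "lcs sm P" and l1: "equiv_l1_basis sm P a"
  obtains ch I C where "finite I" "0 \<le> C" "\<And>n. Vector_Spaces.linear sm (*) (ch n)" "\<And>n. ch n (a n) = 1"
    "\<And>c N x. norm (\<Sum>n<N. c n * ch n x) \<le> C * sqrt (\<Sum>n<N. (norm (c n))\<^sup>2) * (\<Sum>i\<in>I. P i x)"
proof -
  have vs: "vector_space sm" and P: "\<And>i. seminorm sm (P i)" using lcs by (auto simp: lcs_def)
  interpret vector_space sm by fact
  define S where "S = span (range a)"
  have P0: "P i 0 = 0" for i using P[of i] unfolding seminorm_def by (metis mult_zero_left norm_zero scale_zero_left)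
  have S: "S \<subseteq> lcs_closure P S" unfolding lcs_closure_def by (auto intro!: bexI simp: P0)
  obtain R :: "'a \<Rightarrow> nat \<Rightarrow> 'k" where R: "(\<forall>x\<in>lcs_closure P S. R x \<in> l1_space) \<and>
        (\<forall>x\<in>lcs_closure P S. \<forall>y\<in>lcs_closure P S. R (x + y) = (\<lambda>m. R x m + R y m)) \<and>
        (\<forall>x\<in>lcs_closure P S. \<forall>c. R (sm c x) = (\<lambda>m. c * R x m)) \<and>
        inj_on R (lcs_closure P S) \<and> (\<forall>n. R (a n) = unit_vec n) \<and>
        (\<exists>I C. finite I \<and> (\<forall>x\<in>lcs_closure P S. l1_norm (R x) \<le> C * (\<Sum>i\<in>I. P i x))) \<and>
        (\<forall>i. \<exists>C. \<forall>x\<in>lcs_closure P S. P i x \<le> C * l1_norm (R x))"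
    using l1 unfolding equiv_l1_basis_def Let_def S_def by (rule exE)
  have R1: "R x \<in> l1_space" and R_add': "y \<in> S \<Longrightarrow> R (x + y) = (\<lambda>m. R x m + R y m)"
    and R_scale': "R (sm c x) = (\<lambda>m. c * R x m)" if "x \<in> S" for x y c
    using R S that by blast+
  have Ra: "R (a n) = unit_vec n" for n using R by blast
  obtain I C0 where I: "finite I" and RC: "\<And>x. x \<in> S \<Longrightarrow> l1_norm (R x) \<le> C0 * (\<Sum>i\<in>I. P i x)"
    using R S by blast
  have R_add: "R (x + y) m = R x m + R y m" if "x \<in> S" "y \<in> S" for x y m using R_add'[OF that] by simp
  have R_scale: "R (sm c x) m = c * R x m" if "x \<in> S" for x c m using R_scale'[OF that] by simp
  define C where "C = \<bar>C0\<bar>"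
  define p where "p x = C * (\<Sum>i\<in>I. P i x)" for x
  have p: "seminorm sm p" unfolding p_def by (rule seminorm_scaled_sum) (auto simp: C_def P)
  have Rp: "(\<Sum>m<N. norm (R x m)) \<le> p x" if "x \<in> S" for x N
  proof -
    have "(\<Sum>m<N. norm (R x m)) \<le> l1_norm (R x)"
      using R1[OF that] unfolding l1_norm_def l1_space_def by (intro sum_le_suminf) auto
    also have "\<dots> \<le> C0 * (\<Sum>i\<in>I. P i x)" using RC[OF that] .
    also have "\<dots> \<le> p x" unfolding p_def C_def
      by (intro mult_right_mono sum_nonneg) (auto intro: seminorm_nonneg[OF vs P])
    finally show ?thesis .
  qed
  have S_sub: "subspace S" unfolding S_def by simp
  have R0: "R 0 m = 0" for m using R_scale[OF subspace_0[OF S_sub], of 0 m] by simp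
  define V where "V = {u. \<forall>m. coeff u m \<in> S}"
  define F0 where "F0 u = (\<Sum>m<Suc (degree u). R (coeff u m) m)" for u
  have F0_eq: "F0 u = (\<Sum>m<n. R (coeff u m) m)" if "degree u < n" for u n
    unfolding F0_def using that
    by (intro sum.mono_neutral_left) (auto simp: coeff_eq_0 R0)
  have vsp: "vector_space (\<lambda>c. map_poly (sm c))" using vs by (rule vector_space_map_poly)
  obtain F where F: "Vector_Spaces.linear (\<lambda>c. map_poly (sm c)) (*) F"
    and FV: "\<And>u. u \<in> V \<Longrightarrow> F u = F0 u" and F_le: "\<And>u. norm (F u) \<le> 2 * rademacher_seminorm p u"
  proof (rule Hahn_Banach_seminorm[OF vsp seminorm_rademacher[OF vs p]])
    show "module.subspace (\<lambda>c. map_poly (sm c)) V"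
      using vsp S_sub
      by (auto simp: module.subspace_def module_iff_vector_space V_def coeff_map_poly
          subspace_0 subspace_add subspace_scale)
  next
    fix u v assume uv: "u \<in> V" "v \<in> V"
    define n where "n = Suc (max (degree u) (degree v))"
    have n: "degree u < n" "degree v < n" "degree (u + v) < n"
      using degree_add_le_max[of u v] by (auto simp: n_def)
    show "F0 (u + v) = F0 u + F0 v"
      unfolding n[THEN F0_eq] using uv by (simp add: V_def R_add sum.distrib)
  next
    fix c u assume u: "u \<in> V"
    define n where "n = Suc (degree u)"
    have n: "degree u < n" "degree (map_poly (sm c) u) < n"
      using map_poly_degree_leq[of "sm c" u] by (auto simp: n_def)
    show "F0 (map_poly (sm c) u) = c * F0 u"
      unfolding n[THEN F0_eq] using u by (simp add: V_def R_scale coeff_map_poly sum_distrib_left)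
  next
    fix u assume u: "u \<in> V"
    define n where "n = Suc (degree u)"
    have n: "degree u < n" by (simp add: n_def)
    have "norm (F0 u) \<le> (\<Sum>m<n. norm (R (coeff u m) m))"
      unfolding F0_eq[OF n] by (rule norm_sum)
    \<comment> \<open>The first sum is empty; it matches the diagonal estimate at N = n with offset
      0.\<close>
    also have "\<dots> \<le> (\<Sum>m=n..<n. norm (R 0 m)) + (\<Sum>m<n. norm (R (coeff u m) m))" by simp
    also have "\<dots> \<le> rademacher_mean p (coeff u) n 0"
      by (rule sum_diagonal_le_rademacher_mean[where S = S])
         (use S_sub u Rp in \<open>auto simp: V_def R_add subspace_add subspace_diff subspace_0\<close>)
    finally show "norm (F0 u) \<le> rademacher_seminorm p u"
      unfolding rademacher_seminorm_eq[OF n] .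
  qed blast
  interpret F: Vector_Spaces.linear "\<lambda>c. map_poly (sm c)" "(*)" F by (fact F)
  define ch where "ch n x = F (monom x n)" for n x
  have chi_scale: "ch n (sm c x) = c * ch n x" for n c x
    using F.scale[of c "monom x n"] by (simp add: ch_def map_poly_monom)
  show thesis
  proof
    show "finite I" by (fact I)
    show "0 \<le> 2 * C" by (simp add: C_def)
    show "Vector_Spaces.linear sm (*) (ch n)" for n
      by unfold_locales (auto simp: chi_scale algebra_simps, simp add: ch_def F.add flip: add_monom)
    show "ch n (a n) = 1" for n
    proof -
      have "a n \<in> S" unfolding S_def by (rule span_base) simp
      then have "monom (a n) n \<in> V" using subspace_0[OF S_sub] by (auto simp: V_def)
      then have "ch n (a n) = (\<Sum>m<Suc n. R (coeff (monom (a n) n) m) m)"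
        unfolding ch_def using F0_eq[of "monom (a n) n" "Suc n"] degree_monom_le[of "a n" n] by (simp add: FV del: sum.lessThan_Suc)
      also have "\<dots> = (\<Sum>m<Suc n. if m = n then 1 else 0)"
        by (rule sum.cong) (auto simp: R0 Ra unit_vec_def)
      finally show ?thesis by simp
    qed
    show "norm (\<Sum>n<N. c n * ch n x) \<le> (2 * C) * sqrt (\<Sum>n<N. (norm (c n))\<^sup>2) * (\<Sum>i\<in>I. P i x)" for c N x
    proof -
      define u where "u = (\<Sum>n<N. monom (sm (c n) x) n)"
      define d where "d k = (if k < N then c k else 0)" for k
      \<comment> \<open>The degree of \<open>u\<close> may be small because entries
        \<open>sm (c n) x\<close> can vanish, so the cutoff has to reach \<open>N\<close> as well as
        exceed the degree.\<close>
      define M where "M = max N (Suc (degree u))"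
      have cu: "coeff u = (\<lambda>k. sm (d k) x)"
        by (auto simp: u_def coeff_sum d_def fun_eq_iff sum.delta)
      have "(\<Sum>n<N. c n * ch n x) = F u"
        unfolding u_def F.sum by (simp add: chi_scale flip: ch_def)
      then have "norm (\<Sum>n<N. c n * ch n x) \<le> 2 * rademacher_seminorm p u" using F_le by simp
      also have "rademacher_seminorm p u = rademacher_mean p (\<lambda>k. sm (d k) x) M (sm 0 x)"
        unfolding cu[symmetric] by (subst rademacher_seminorm_eq[of _ M]) (auto simp: M_def)
      also have "\<dots> = rademacher_mean norm d M 0 * p x"
        by (rule rademacher_mean_scale_vector[OF vs p])
      also have "\<dots> \<le> sqrt ((norm (0::'k))\<^sup>2 + (\<Sum>k<M. (norm (d k))\<^sup>2)) * p x"
        by (intro mult_right_mono rademacher_mean_norm_le seminorm_nonneg[OF vs p])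
      also have "(\<Sum>k<M. (norm (d k))\<^sup>2) = (\<Sum>k<N. (norm (c k))\<^sup>2)"
        by (rule sum.mono_neutral_cong_right) (auto simp: M_def d_def)
      finally show ?thesis by (simp add: p_def algebra_simps)
    qed
  qed
qed

section \<open>Subsets of locally convex spaces\<close>

text \<open>The terms are eventually below 1 in absolute value, where raising the exponent above 2
  only shrinks them. This is where 2 \<le> p matters.\<close>

lemma in_lp_of_square_summable:
  assumes "2 \<le> p" "summable (\<lambda>n. (a n)\<^sup>2)"
  shows "in_lp p a"
proof -
  have "(\<lambda>n. (a n)\<^sup>2) \<longlonglongrightarrow> 0" using assms(2) by (rule summable_LIMSEQ_zero)
  then have "(\<lambda>n. sqrt ((a n)\<^sup>2)) \<longlonglongrightarrow> sqrt 0" by (rule tendsto_real_sqrt)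
  then have a0: "a \<longlonglongrightarrow> 0" by (simp add: tendsto_rabs_zero_iff)
  show ?thesis
  proof (cases "p = \<infinity>")
    case True
    then show ?thesis using a0 by (simp add: in_lp_def)
  next
    case False
    then obtain r where r: "p = ereal r" "2 \<le> r" using assms(1) by (cases p) auto
    have "\<forall>\<^sub>F n in sequentially. \<bar>a n\<bar> < 1"
      using a0 by (metis order_tendstoD(2) tendsto_rabs_zero zero_less_one)
    then have "\<forall>\<^sub>F n in sequentially. norm (\<bar>a n\<bar> powr r) \<le> (a n)\<^sup>2"
    proof eventually_elim
      case (elim n)
      have "\<bar>a n\<bar> powr r \<le> \<bar>a n\<bar> powr 2"
        using r elim by (intro powr_mono') auto
      also have "\<dots> = (a n)\<^sup>2" by (cases "a n = 0") (auto simp: powr_numeral)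
      finally show ?case by simp
    qed
    then have "summable (\<lambda>n. \<bar>a n\<bar> powr r)" using assms(2) by (rule summable_comparison_test_ev)
    then show ?thesis by (simp add: in_lp_def r)
  qed
qed

lemma in_lp_tendsto_zero:
  assumes "0 < p" "in_lp p a"
  shows "a \<longlonglongrightarrow> 0"
proof (cases "p = \<infinity>")
  case True
  then show ?thesis using assms by (simp add: in_lp_def)
next
  case False
  then obtain r where r: "p = ereal r" "0 < r" using assms(1) by (cases p) auto
  have "(\<lambda>n. \<bar>a n\<bar> powr r) \<longlonglongrightarrow> 0"
    using assms(2) by (simp add: in_lp_def r summable_LIMSEQ_zero)
  then have "(\<lambda>n. (\<bar>a n\<bar> powr r) powr (1 / r)) \<longlonglongrightarrow> 0 powr (1 / r)"
    by (rule tendsto_powr2) (use r in auto)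
  then show ?thesis using r by (simp add: powr_powr tendsto_rabs_zero_iff)
qed

section \<open>Functionals on the strong dual and weak square-summability\<close>

lemma dualI:
  assumes "Vector_Spaces.linear sm (*) f" "finite I" "\<And>x. norm (f x) \<le> C * (\<Sum>i\<in>I. P i x)"
  shows "f \<in> dual sm P"
  using assms by (auto simp: dual_def)

text \<open>A finite sum of the generating seminorms is bounded, by some \<open>L\<close>, on the
  bounded set \<open>B\<close> that controls \<open>\<Phi>\<close>. Functionals dominated by
  \<open>K\<close> times that sum are thus at most \<open>K * L\<close> on \<open>B\<close>, and
  \<open>D\<close> depends on \<open>\<Phi>\<close> and \<open>I\<close> alone.\<close>

lemma strong_bidual_bound:
  fixes sm :: "'k::real_normed_field \<Rightarrow> 'a::ab_group_add \<Rightarrow> 'a"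
  assumes "\<Phi> \<in> strong_bidual sm P" "finite I"
  obtains D where "0 \<le> D"
    "\<And>f K. f \<in> dual sm P \<Longrightarrow> 0 \<le> K \<Longrightarrow> (\<And>x. norm (f x) \<le> K * (\<Sum>i\<in>I. P i x)) \<Longrightarrow> norm (\<Phi> f) \<le> D * K"
proof -
  obtain B C where B: "lcs_bounded P B"
    and Phi: "\<And>f. f \<in> dual sm P \<Longrightarrow> ereal (norm (\<Phi> f)) \<le> ereal C * supnorm_on f B"
    using assms(1) unfolding strong_bidual_def by blast
  obtain M where M: "\<And>i x. x \<in> B \<Longrightarrow> P i x \<le> M i"
    using B unfolding lcs_bounded_def by metis
  define L where "L = (\<Sum>i\<in>I. \<bar>M i\<bar>)"
  have L0: "0 \<le> L" by (simp add: L_def sum_nonneg)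
  have L: "(\<Sum>i\<in>I. P i x) \<le> L" if "x \<in> B" for x
    unfolding L_def using M[OF that] by (intro sum_mono) (metis abs_ge_self order_trans)
  have "norm (\<Phi> f) \<le> (\<bar>C\<bar> * L) * K"
    if f: "f \<in> dual sm P" "0 \<le> K" "\<And>x. norm (f x) \<le> K * (\<Sum>i\<in>I. P i x)" for f K
  proof -
    have f0: "f 0 = 0" using f(1) by (auto simp: dual_def dest!: Vector_Spaces.linear.axioms(3) module_hom.zero)
    \<comment> \<open>The sign of \<open>C\<close> is unknown; nonnegativity of the supremum permits
      replacing \<open>C\<close> by its absolute value.\<close>
    have nonneg: "0 \<le> supnorm_on f B"
      unfolding supnorm_on_def by (rule SUP_upper2[of 0]) auto
    have "norm (f x) \<le> K * L" if "x \<in> insert 0 B" for x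
      using that f(3)[of x] mult_left_mono[OF L f(2), of x] f0 f(2) L0 by auto
    then have "supnorm_on f B \<le> ereal (K * L)"
      unfolding supnorm_on_def by (intro SUP_least) simp
    then have "ereal \<bar>C\<bar> * supnorm_on f B \<le> ereal \<bar>C\<bar> * ereal (K * L)"
      by (rule ereal_mult_left_mono) simp
    moreover have "ereal C * supnorm_on f B \<le> ereal \<bar>C\<bar> * supnorm_on f B"
      using nonneg by (intro ereal_mult_right_mono) auto
    ultimately have "ereal (norm (\<Phi> f)) \<le> ereal \<bar>C\<bar> * ereal (K * L)"
      using Phi[OF f(1)] by (meson order_trans)
    then show ?thesis by (simp add: mult_ac)
  qed
  then show thesis using that[of "\<bar>C\<bar> * L"] L0 by simp
qed

text \<open>Duality of l_2 with itself: for \<open>T\<close> the partial sum of the squares, testing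
  the estimate with the conjugates of the values \<open>\<Phi> (ch n)\<close> gives T \<le> D C sqrt
  T, so T is at most the square of D C.\<close>

lemma strong_bidual_square_summable:
  fixes sm :: "'k::real_normed_field \<Rightarrow> 'a::ab_group_add \<Rightarrow> 'a"
  assumes vs: "vector_space sm" and I: "finite I" and C: "0 \<le> C" and lin: "\<And>n. Vector_Spaces.linear sm (*) (ch n)"
    and ch: "\<And>c N x. norm (\<Sum>n<N. c n * ch n x) \<le> C * sqrt (\<Sum>n<N. (norm (c n))\<^sup>2) * (\<Sum>i\<in>I. P i x)"
  shows "ch n \<in> dual sm P" "\<Phi> \<in> strong_bidual sm P \<Longrightarrow> summable (\<lambda>n. (norm (\<Phi> (ch n)))\<^sup>2)"
proof -
  interpret vector_space sm by fact
  interpret ch: Vector_Spaces.linear sm "(*)" "ch n" for n by (fact lin)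
  define f where "f c N = (\<lambda>x. \<Sum>n<N. c n * ch n x)" for c :: "nat \<Rightarrow> 'k" and N
  have f_dual: "f c N \<in> dual sm P" for c N
  proof (rule dualI[OF _ I])
    show "Vector_Spaces.linear sm (*) (f c N)"
      unfolding f_def
      by unfold_locales (auto simp: ch.add ch.scale sum.distrib sum_distrib_left algebra_simps)
    show "norm (f c N x) \<le> (C * sqrt (\<Sum>n<N. (norm (c n))\<^sup>2)) * (\<Sum>i\<in>I. P i x)" for x
      unfolding f_def by (rule ch)
  qed
  have ch_f: "ch n = f (\<lambda>k. if k = n then 1 else 0) (Suc n)" for n
  proof
    fix x
    have "(\<Sum>k<Suc n. (if k = n then 1 else 0) * ch k x) = (\<Sum>k<Suc n. if k = n then ch k x else 0)"
      by (rule sum.cong) auto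
    then show "ch n x = f (\<lambda>k. if k = n then 1 else 0) (Suc n) x" by (simp add: f_def)
  qed
  show ch_dual: "ch n \<in> dual sm P" for n
    unfolding ch_f[of n] by (rule f_dual)
  show "summable (\<lambda>n. (norm (\<Phi> (ch n)))\<^sup>2)" if Phi: "\<Phi> \<in> strong_bidual sm P"
  proof -
    have Phi_add: "\<Phi> (\<lambda>x. g x + h x) = \<Phi> g + \<Phi> h" if "g \<in> dual sm P" "h \<in> dual sm P" for g h
      using Phi that by (auto simp: strong_bidual_def)
    have Phi_scale: "\<Phi> (\<lambda>x. c * g x) = c * \<Phi> g" if "g \<in> dual sm P" for g c
      using Phi that by (auto simp: strong_bidual_def)
    have scale_dual: "(\<lambda>x. c * ch n x) \<in> dual sm P" for c n
    proof -
      have "(\<lambda>x. c * ch n x) = f (\<lambda>k. if k = n then c else 0) (Suc n)"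
      proof
        fix x
        have "(\<Sum>k<Suc n. (if k = n then c else 0) * ch k x) = (\<Sum>k<Suc n. if k = n then c * ch k x else 0)"
          by (rule sum.cong) auto
        then show "c * ch n x = f (\<lambda>k. if k = n then c else 0) (Suc n) x" by (simp add: f_def)
      qed
      then show ?thesis using f_dual by simp
    qed
    have Phi_f: "\<Phi> (f c N) = (\<Sum>n<N. c n * \<Phi> (ch n))" for c N
    proof (induction N)
      case 0
      \<comment> \<open>The value at the zero functional comes from homogeneity, writing the empty
        sum as a multiple of \<open>ch 0\<close>.\<close>
      have "\<Phi> (\<lambda>x. 0 * ch 0 x) = 0 * \<Phi> (ch 0)" by (rule Phi_scale[OF ch_dual])
      then show ?case by (simp add: f_def)
    next
      case (Suc N)
      have "f c (Suc N) = (\<lambda>x. f c N x + c N * ch N x)" by (simp add: f_def)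
      then have "\<Phi> (f c (Suc N)) = \<Phi> (f c N) + \<Phi> (\<lambda>x. c N * ch N x)"
        using Phi_add[OF f_dual scale_dual] by simp
      then show ?case using Suc Phi_scale[OF ch_dual] by simp
    qed
    obtain D where D: "0 \<le> D"
      "\<And>f K. f \<in> dual sm P \<Longrightarrow> 0 \<le> K \<Longrightarrow> (\<And>x. norm (f x) \<le> K * (\<Sum>i\<in>I. P i x)) \<Longrightarrow> norm (\<Phi> f) \<le> D * K"
      using strong_bidual_bound[OF Phi I] by blast
    show ?thesis
    proof (rule summableI_nonneg_bounded)
      fix N
      define T where "T = (\<Sum>n<N. (norm (\<Phi> (ch n)))\<^sup>2)"
      have T0: "0 \<le> T" by (simp add: T_def sum_nonneg)
      \<comment> \<open>\<open>c n\<close> is the conjugate of \<open>\<Phi> (ch n)\<close>, and 0 where \<open>\<Phi> (ch n) = 0\<close>.\<close>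
      define c where "c n = of_real ((norm (\<Phi> (ch n)))\<^sup>2) / \<Phi> (ch n)" for n
      have nc: "norm (c n) = norm (\<Phi> (ch n))" for n
        by (simp add: c_def norm_divide norm_mult power2_eq_square)
      have cP: "c n * \<Phi> (ch n) = of_real ((norm (\<Phi> (ch n)))\<^sup>2)" for n
        by (simp add: c_def)
      have "\<Phi> (f c N) = of_real T" by (simp add: Phi_f cP T_def del: of_real_power)
      then have "T = norm (\<Phi> (f c N))" using T0 by simp
      also have "\<dots> \<le> D * (C * sqrt T)"
      proof (rule D(2)[OF f_dual])
        show "0 \<le> C * sqrt T" using C T0 by simp
        show "norm (f c N x) \<le> C * sqrt T * (\<Sum>i\<in>I. P i x)" for x
          using ch[where c = c and N = N and x = x] by (simp add: f_def nc T_def)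
      qed
      finally have T_le: "sqrt T * sqrt T \<le> (D * C) * sqrt T" using T0 by simp
      have "sqrt T \<le> D * C"
      proof (cases "T = 0")
        case True
        then show ?thesis using D(1) C by simp
      next
        case False
        then have "0 < sqrt T" using T0 by simp
        with T_le show ?thesis using mult_right_le_imp_le by blast
      qed
      then have "(sqrt T)\<^sup>2 \<le> (D * C)\<^sup>2" using T0 by (intro power_mono) auto
      then show "(\<Sum>n<N. (norm (\<Phi> (ch n)))\<^sup>2) \<le> (D * C)\<^sup>2" using T0 by (simp add: T_def)
    qed simp
  qed
qed

text \<open>Square-summability under every \<open>\<Phi>\<close> implies weak p-summability, so the
  suprema over \<open>A\<close> tend to 0; values of norm at least 1 at every \<open>a n\<close>
  would prevent this. It serves both boundedness and the exclusion of l_1 sequences.\<close>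

lemma Vstar_set_no_norming_sequence:
  assumes V: "pq_Vstar_set sm P p q A" and "2 \<le> p" "p \<le> q"
    and dual: "\<And>n. ch n \<in> dual sm P"
    and summable: "\<And>\<Phi>. \<Phi> \<in> strong_bidual sm P \<Longrightarrow> summable (\<lambda>n. (norm (\<Phi> (ch n)))\<^sup>2)"
    and A: "\<And>n. a n \<in> A"
  shows "\<exists>n. norm (ch n (a n)) < 1"
proof (rule ccontr)
  assume "\<not> ?thesis"
  then have ge: "1 \<le> norm (ch n (a n))" for n by (simp add: not_less)
  define s where "s n = (SUP x\<in>A. ereal (norm (ch n x)))" for n
  have "weakly_p_summable_strong_dual sm P p ch"
    unfolding weakly_p_summable_strong_dual_def
    using dual summable by (auto intro!: in_lp_of_square_summable \<open>2 \<le> p\<close>)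
  then have fin: "s n < \<infinity>" and lp: "in_lp q (\<lambda>n. real_of_ereal (s n))" for n
    using V by (auto simp: pq_Vstar_set_def s_def)
  have "(0::ereal) < 2" by simp
  then have "0 < q" using assms(2,3) by (meson less_le_trans order_trans)
  then have lim: "(\<lambda>n. real_of_ereal (s n)) \<longlonglongrightarrow> 0" using lp by (rule in_lp_tendsto_zero)
  have "1 \<le> real_of_ereal (s n)" for n
  proof -
    have "ereal 1 \<le> s n" unfolding s_def using ge A by (intro SUP_upper2[of "a n"]) auto
    \<comment> \<open>Finiteness matters here because \<open>real_of_ereal\<close> sends infinity to
      0.\<close>
    then show ?thesis using fin[of n] by (cases "s n") auto
  qed
  then have "(1::real) \<le> 0" by (intro LIMSEQ_le_const[OF lim]) auto
  then show False by simp
qed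

text \<open>Hahn-Banach applied to the functional c a \<mapsto> c p(a) on the line through
  \<open>a\<close>.\<close>

lemma seminorm_norming_functional:
  fixes sm :: "'k::real_normed_field \<Rightarrow> 'a::ab_group_add \<Rightarrow> 'a"
  assumes vs: "vector_space sm" and p: "seminorm sm p" and a: "p a \<noteq> 0"
  obtains g where "Vector_Spaces.linear sm (*) g" "g a = of_real (p a)" "\<And>x. norm (g x) \<le> 2 * p x"
proof -
  interpret vector_space sm by fact
  have scale: "p (sm c x) = norm c * p x" for c x using p by (simp add: seminorm_def)
  have "a \<noteq> 0" using a scale[of 0 0] by auto
  \<comment> \<open>The coordinate on that line, unique because \<open>a\<close> is nonzero.\<close>
  define k where "k x = (THE c. x = sm c a)" for x
  have k: "k (sm c a) = c" for c
    unfolding k_def using \<open>a \<noteq> 0\<close> by (intro the_equality) auto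
  have sub: "subspace (range (\<lambda>c. sm c a))"
    unfolding subspace_def by (auto simp flip: scale_left_distrib intro: image_eqI[of _ _ 0])
  obtain g where g: "Vector_Spaces.linear sm (*) g"
    "\<And>x. x \<in> range (\<lambda>c. sm c a) \<Longrightarrow> g x = k x * of_real (p a)" "\<And>x. norm (g x) \<le> 2 * p x"
    by (rule Hahn_Banach_seminorm[OF vs p sub, of "\<lambda>x. k x * of_real (p a)"])
       (auto simp: k scale norm_mult seminorm_nonneg[OF vs p] distrib_right simp flip: scale_left_distrib)
  show thesis
  proof (rule that[OF g(1) _ g(3)])
    have "g (sm 1 a) = k (sm 1 a) * of_real (p a)" by (rule g(2)) blast
    then show "g a = of_real (p a)" unfolding k by simp
  qed
qed

text \<open>Points with \<open>P i (a n)\<close> above 2^n make the norming functionals, scaled by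
  2^(-n), exceed 1 at \<open>a n\<close>. All are dominated by the single seminorm
  \<open>P i\<close> with geometrically decaying constants, so each \<open>\<Phi>\<close> is
  square-summable along them.\<close>

lemma Vstar_set_bounded:
  fixes sm :: "'k::real_normed_field \<Rightarrow> 'a::ab_group_add \<Rightarrow> 'a"
  assumes lcs: "lcs sm P" and "2 \<le> p" "p \<le> q" and V: "pq_Vstar_set sm P p q A"
  shows "lcs_bounded P A"
proof (rule ccontr)
  have vs: "vector_space sm" and P: "\<And>i. seminorm sm (P i)" using lcs by (auto simp: lcs_def)
  assume "\<not> lcs_bounded P A"
  then obtain i where "\<forall>M. \<exists>x\<in>A. M < P i x" by (auto simp: lcs_bounded_def not_le)
  then have "\<forall>n::nat. \<exists>x. x \<in> A \<and> 2 ^ n < P i x" by blast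
  then obtain a where a: "\<And>n::nat. a n \<in> A" "\<And>n. 2 ^ n < P i (a n)" by metis
  have pos: "P i (a n) \<noteq> 0" for n using a(2)[of n] zero_less_power[of "2::real" n] by linarith
  have "\<exists>g. Vector_Spaces.linear sm (*) g \<and> g (a n) = of_real (P i (a n)) \<and> (\<forall>x. norm (g x) \<le> 2 * P i x)" for n
    using seminorm_norming_functional[OF vs P pos] by metis
  then obtain g where g: "\<And>n. Vector_Spaces.linear sm (*) (g n)" "\<And>n. g n (a n) = of_real (P i (a n))"
    "\<And>n x. norm (g n x) \<le> 2 * P i x" by metis
  define ch where "ch n x = of_real ((1 / 2) ^ n) * g n x" for n x
  have bound: "norm (ch n x) \<le> (2 * (1 / 2) ^ n) * (\<Sum>i\<in>{i}. P i x)" for n x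
    using mult_left_mono[OF g(3)[of n x], of "(1 / 2) ^ n"]
    by (simp add: ch_def norm_mult norm_power norm_divide mult_ac)
  have dual: "ch n \<in> dual sm P" for n
  proof (rule dualI[OF _ _ bound])
    interpret g: Vector_Spaces.linear sm "(*)" "g n" by (fact g)
    show "Vector_Spaces.linear sm (*) (ch n)"
      unfolding ch_def by unfold_locales (simp_all add: g.add g.scale algebra_simps)
  qed simp
  have "\<exists>n. norm (ch n (a n)) < 1"
  proof (rule Vstar_set_no_norming_sequence[OF V assms(2,3) dual _ a(1)])
    fix \<Phi> assume "\<Phi> \<in> strong_bidual sm P"
    then obtain D where D: "0 \<le> D"
      "\<And>f K. f \<in> dual sm P \<Longrightarrow> 0 \<le> K \<Longrightarrow> (\<And>x. norm (f x) \<le> K * (\<Sum>i\<in>{i}. P i x)) \<Longrightarrow> norm (\<Phi> f) \<le> D * K"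
      using strong_bidual_bound[of \<Phi> sm P "{i}"] by blast
    have "norm (\<Phi> (ch n)) \<le> D * (2 * (1 / 2) ^ n)" for n
      by (rule D(2)[OF dual]) (use bound in auto)
    then have "(norm (\<Phi> (ch n)))\<^sup>2 \<le> (D * (2 * (1 / 2) ^ n))\<^sup>2" for n by (rule power_mono) simp
    also have "(D * (2 * (1 / 2) ^ n))\<^sup>2 = 4 * D\<^sup>2 * (1 / 4) ^ n" for n
    proof -
      have "((1 / 2 :: real) ^ n)\<^sup>2 = (1 / 4) ^ n"
        by (simp add: power2_eq_square flip: power_mult_distrib)
      then show ?thesis by (simp only: power_mult_distrib) simp
    qed
    finally have "norm ((norm (\<Phi> (ch n)))\<^sup>2) \<le> 4 * D\<^sup>2 * (1 / 4) ^ n" for n by simp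
    moreover have "summable (\<lambda>n. 4 * D\<^sup>2 * (1 / 4) ^ n)"
      by (intro summable_mult summable_geometric) simp
    ultimately show "summable (\<lambda>n. (norm (\<Phi> (ch n)))\<^sup>2)"
      by (rule summable_comparison_test'[rotated])
  qed
  then obtain n where n: "norm (ch n (a n)) < 1" by blast
  have "norm (ch n (a n)) = (1 / 2) ^ n * P i (a n)"
    using seminorm_nonneg[OF vs P, of i "a n"] by (simp add: ch_def g(2) norm_mult norm_power norm_divide)
  with n a(2)[of n] show False by (simp add: power_divide field_simps)
qed

lemma Vstar_set_weakly_seq_precompact:
  fixes sm :: "'k::real_normed_field \<Rightarrow> 'a::ab_group_add \<Rightarrow> 'a"
  assumes lcs: "lcs sm P" and "2 \<le> p" "p \<le> q" and ros: "rosenthal_property sm P"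
    and V: "pq_Vstar_set sm P p q A"
  shows "weakly_seq_precompact sm P A"
  unfolding weakly_seq_precompact_def
proof (intro allI impI)
  have vs: "vector_space sm" using lcs by (simp add: lcs_def)
  fix x :: "nat \<Rightarrow> 'a" assume x: "\<forall>n. x n \<in> A"
  have "lcs_bounded P (range x)"
    using Vstar_set_bounded[OF lcs assms(2,3) V] x unfolding lcs_bounded_def by (metis rangeE)
  then obtain r :: "nat \<Rightarrow> nat" where r: "strict_mono r"
    "weakly_Cauchy sm P (x \<circ> r) \<or> equiv_l1_basis sm P (x \<circ> r)"
    using ros unfolding rosenthal_property_def by blast
  have "\<not> equiv_l1_basis sm P (x \<circ> r)"
  proof
    assume "equiv_l1_basis sm P (x \<circ> r)"
    then obtain ch I C where ch: "finite I" "0 \<le> C" "\<And>n. Vector_Spaces.linear sm (*) (ch n)"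
      and one: "\<And>n. ch n ((x \<circ> r) n) = 1"
      and bound: "\<And>c N x. norm (\<Sum>n<N. c n * ch n x) \<le> C * sqrt (\<Sum>n<N. (norm (c n))\<^sup>2) * (\<Sum>i\<in>I. P i x)"
      by (rule l1_basis_biorthogonal_sequence[OF lcs]) (rule that)
    have "\<exists>n. norm (ch n ((x \<circ> r) n)) < 1"
    proof (rule Vstar_set_no_norming_sequence[OF V assms(2,3)])
      show "ch n \<in> dual sm P" for n
        by (rule strong_bidual_square_summable(1)[OF vs ch bound])
      show "summable (\<lambda>n. (norm (\<Phi> (ch n)))\<^sup>2)" if "\<Phi> \<in> strong_bidual sm P" for \<Phi>
        using that by (rule strong_bidual_square_summable(2)[OF vs ch bound])
    qed (simp add: x)
    then show False using one by simp
  qed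
  with r show "\<exists>r. strict_mono r \<and> weakly_Cauchy sm P (x \<circ> r)" by blast
qed

text \<open>Evaluation at x is continuous on the strong dual, being controlled by the bounded set
  {x}; so weak p-summability there implies weak* p-summability. The two suprema agree because
  \<open>A\<close> is nonempty and functionals vanish at 0.\<close>

lemma limited_imp_Vstar_set:
  fixes sm :: "'k::real_normed_field \<Rightarrow> 'a::ab_group_add \<Rightarrow> 'a"
  assumes lim: "pq_limited_set sm P p q A"
  shows "pq_Vstar_set sm P p q A"
proof -
  have ne: "A \<noteq> {}" using lim by (simp add: pq_limited_set_def)
  have eq: "(SUP a\<in>A. ereal (norm (f a))) = supnorm_on f A" if "f \<in> dual sm P" for f
  proof -
    have f0: "f 0 = 0" using that by (auto simp: dual_def dest!: Vector_Spaces.linear.axioms(3) module_hom.zero)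
    obtain a where "a \<in> A" using ne by blast
    then have "0 \<le> (SUP a\<in>A. ereal (norm (f a)))" by (intro SUP_upper2[of a]) auto
    then show ?thesis by (simp add: supnorm_on_def f0 sup_absorb2 zero_ereal_def[symmetric])
  qed
  have eval: "(\<lambda>f. f x) \<in> strong_bidual sm P" for x
  proof -
    have "ereal (norm (f x)) \<le> ereal 1 * supnorm_on f {x}" for f :: "'a \<Rightarrow> 'k"
      unfolding supnorm_on_def one_ereal_def[symmetric] mult_1 by (rule SUP_upper) simp
    moreover have "lcs_bounded P {x}" by (auto simp: lcs_bounded_def)
    ultimately show ?thesis unfolding strong_bidual_def by blast
  qed
  show ?thesis
    unfolding pq_Vstar_set_def
  proof (intro conjI allI impI ne)
    fix ch assume ch: "weakly_p_summable_strong_dual sm P p ch"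
    then have "weak_star_p_summable sm P p ch"
      using eval unfolding weakly_p_summable_strong_dual_def weak_star_p_summable_def by fastforce
    moreover have "ch n \<in> dual sm P" for n
      using ch by (simp add: weakly_p_summable_strong_dual_def)
    ultimately show "(SUP a\<in>A. ereal (norm (ch n a))) < \<infinity>"
      "in_lp q (\<lambda>n. real_of_ereal (SUP a\<in>A. ereal (norm (ch n a))))" for n
      using lim by (auto simp: pq_limited_set_def eq)
  qed
qed

theorem theoremt:
  fixes sm :: "'k::real_normed_field \<Rightarrow> 'a::ab_group_add \<Rightarrow> 'a"
    and P :: "'i \<Rightarrow> 'a \<Rightarrow> real"
    and p q :: ereal
  assumes "lcs sm P"
    and "2 \<le> p" and "p \<le> q"
    and "rosenthal_property sm P"
  shows "(\<forall>A. pq_Vstar_set sm P p q A \<longrightarrow> weakly_seq_precompact sm P A) \<and>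
         (\<forall>A. pq_limited_set sm P p q A \<longrightarrow> weakly_seq_precompact sm P A)"
  using Vstar_set_weakly_seq_precompact[OF assms] limited_imp_Vstar_set by blast

end
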